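(* Let $(X,\mathfrak A,\zeta)$ be a $\sigma$-finite measure space and $K$ a self-adjoint operator in $L^2(X,\zeta)$ which is bounded from below. (a) If $e^{-tK}$ is positivity improving for all $t>0$, then $$\inf\sigma(K)=-\lim_{t\to\infty}\frac1t\ln\langle\psi,e^{-tK}\psi\rangle$$ for every non-negative $\psi\in L^2(X,\zeta)$ with $\psi\neq0$. (b) If $e^{-tK}$ is merely positivity preserving for all $t>0$, the same identity holds for every $\psi\in L^2(X,\zeta)$ such that $e^{-\tau K}\psi$ is strictly positive ($\zeta$-a.e.) for some $\tau\ge0$.
   Context: An operator $A$ on $L^2(X,\zeta)$ is positivity preserving if $\psi\ge0$ a.e. implies $A\psi\ge0$ a.e., and positivity improving if $\psi\ge0$, $\psi\neq0$ implies $A\psi>0$ a.e. *)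

theory Defs
  imports "HOL-Analysis.Analysis"
begin

text \<open>Complex L2(X,zeta), represented by square-integrable measurable functions;
  elements of L2 are identified up to equality zeta-a.e.\<close>

definition L2 :: "'a measure \<Rightarrow> ('a \<Rightarrow> complex) set" where
  "L2 M = {f. f \<in> borel_measurable M \<and> integrable M (\<lambda>x. (cmod (f x))^2)}"

definition L2_inner :: "'a measure \<Rightarrow> ('a \<Rightarrow> complex) \<Rightarrow> ('a \<Rightarrow> complex) \<Rightarrow> complex" where
  "L2_inner M f g = (LINT x|M. cnj (f x) * g x)"

definition L2_norm :: "'a measure \<Rightarrow> ('a \<Rightarrow> complex) \<Rightarrow> real" where
  "L2_norm M f = sqrt (LINT x|M. (cmod (f x))^2)"

definition ae_eq :: "'a measure \<Rightarrow> ('a \<Rightarrow> complex) \<Rightarrow> ('a \<Rightarrow> complex) \<Rightarrow> bool" where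
  "ae_eq M f g \<longleftrightarrow> (AE x in M. f x = g x)"

definition L2_operator :: "'a measure \<Rightarrow> ('a \<Rightarrow> complex) set \<Rightarrow> (('a \<Rightarrow> complex) \<Rightarrow> ('a \<Rightarrow> complex)) \<Rightarrow> bool" where
  "L2_operator M D K \<longleftrightarrow> D \<subseteq> L2 M \<and> (\<lambda>x. 0) \<in> D \<and>
     (\<forall>f\<in>D. \<forall>g\<in>L2 M. ae_eq M f g \<longrightarrow> g \<in> D \<and> ae_eq M (K f) (K g)) \<and>
     (\<forall>f\<in>D. K f \<in> L2 M) \<and>
     (\<forall>f\<in>D. \<forall>g\<in>D. \<forall>a b. (\<lambda>x. a * f x + b * g x) \<in> D \<and>
         ae_eq M (K (\<lambda>x. a * f x + b * g x)) (\<lambda>x. a * K f x + b * K g x))"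

definition L2_self_adjoint :: "'a measure \<Rightarrow> ('a \<Rightarrow> complex) set \<Rightarrow> (('a \<Rightarrow> complex) \<Rightarrow> ('a \<Rightarrow> complex)) \<Rightarrow> bool" where
  "L2_self_adjoint M D K \<longleftrightarrow> L2_operator M D K \<and>
     (\<forall>f\<in>L2 M. \<forall>e>0. \<exists>g\<in>D. L2_norm M (\<lambda>x. f x - g x) < e) \<and>
     (\<forall>g\<in>L2 M. g \<in> D \<longleftrightarrow> (\<exists>h\<in>L2 M. \<forall>f\<in>D. L2_inner M (K f) g = L2_inner M f h)) \<and>
     (\<forall>f\<in>D. \<forall>g\<in>D. L2_inner M (K f) g = L2_inner M f (K g))"

definition L2_bounded_below :: "'a measure \<Rightarrow> ('a \<Rightarrow> complex) set \<Rightarrow> (('a \<Rightarrow> complex) \<Rightarrow> ('a \<Rightarrow> complex)) \<Rightarrow> bool" where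
  "L2_bounded_below M D K \<longleftrightarrow>
     (\<exists>c::real. \<forall>f\<in>D. c * (L2_norm M f)^2 \<le> Re (L2_inner M f (K f)))"

definition L2_resolvent_set :: "'a measure \<Rightarrow> ('a \<Rightarrow> complex) set \<Rightarrow> (('a \<Rightarrow> complex) \<Rightarrow> ('a \<Rightarrow> complex)) \<Rightarrow> complex set" where
  "L2_resolvent_set M D K = {l. 
     (\<forall>g\<in>L2 M. \<exists>f\<in>D. ae_eq M (\<lambda>x. K f x - l * f x) g) \<and>
     (\<forall>f\<in>D. ae_eq M (\<lambda>x. K f x - l * f x) (\<lambda>x. 0) \<longrightarrow> ae_eq M f (\<lambda>x. 0)) \<and>
     (\<exists>C::real. \<forall>f\<in>D. L2_norm M f \<le> C * L2_norm M (\<lambda>x. K f x - l * f x))}"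

definition L2_spectrum :: "'a measure \<Rightarrow> ('a \<Rightarrow> complex) set \<Rightarrow> (('a \<Rightarrow> complex) \<Rightarrow> ('a \<Rightarrow> complex)) \<Rightarrow> complex set" where
  "L2_spectrum M D K = - L2_resolvent_set M D K"

text \<open>inf sigma(K) (the spectrum of a self-adjoint operator is real).\<close>
definition spectral_bottom :: "'a measure \<Rightarrow> ('a \<Rightarrow> complex) set \<Rightarrow> (('a \<Rightarrow> complex) \<Rightarrow> ('a \<Rightarrow> complex)) \<Rightarrow> real" where
  "spectral_bottom M D K = Inf {r::real. complex_of_real r \<in> L2_spectrum M D K}"

definition L2_bounded_op :: "'a measure \<Rightarrow> (('a \<Rightarrow> complex) \<Rightarrow> ('a \<Rightarrow> complex)) \<Rightarrow> bool" where
  "L2_bounded_op M A \<longleftrightarrow> (\<forall>f\<in>L2 M. A f \<in> L2 M) \<and>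
     (\<forall>f\<in>L2 M. \<forall>g\<in>L2 M. ae_eq M f g \<longrightarrow> ae_eq M (A f) (A g)) \<and>
     (\<forall>f\<in>L2 M. \<forall>g\<in>L2 M. \<forall>a b. ae_eq M (A (\<lambda>x. a * f x + b * g x)) (\<lambda>x. a * A f x + b * A g x)) \<and>
     (\<exists>C::real. \<forall>f\<in>L2 M. L2_norm M (A f) \<le> C * L2_norm M f)"

text \<open>T t = e^{-tK} (t \<ge> 0): the strongly continuous semigroup whose generator is exactly -K.\<close>
definition generates_semigroup :: "'a measure \<Rightarrow> ('a \<Rightarrow> complex) set \<Rightarrow> (('a \<Rightarrow> complex) \<Rightarrow> ('a \<Rightarrow> complex))
     \<Rightarrow> (real \<Rightarrow> ('a \<Rightarrow> complex) \<Rightarrow> ('a \<Rightarrow> complex)) \<Rightarrow> bool" where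
  "generates_semigroup M D K T \<longleftrightarrow>
     (\<forall>t\<ge>0. L2_bounded_op M (T t)) \<and>
     (\<forall>f\<in>L2 M. ae_eq M (T 0 f) f) \<and>
     (\<forall>s\<ge>0. \<forall>t\<ge>0. \<forall>f\<in>L2 M. ae_eq M (T (s + t) f) (T s (T t f))) \<and>
     (\<forall>f\<in>L2 M. ((\<lambda>t. L2_norm M (\<lambda>x. T t f x - f x)) \<longlongrightarrow> 0) (at_right 0)) \<and>
     (\<forall>f\<in>L2 M.
        (f \<in> D \<longrightarrow> ((\<lambda>h. L2_norm M (\<lambda>x. (T h f x - f x) / complex_of_real h + K f x)) \<longlongrightarrow> 0) (at_right 0)) \<and>
        ((\<exists>g\<in>L2 M. ((\<lambda>h. L2_norm M (\<lambda>x. (T h f x - f x) / complex_of_real h - g x)) \<longlongrightarrow> 0) (at_right 0))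
           \<longrightarrow> f \<in> D))"

definition nonneg_fun :: "'a measure \<Rightarrow> ('a \<Rightarrow> complex) \<Rightarrow> bool" where
  "nonneg_fun M f \<longleftrightarrow> (AE x in M. Im (f x) = 0 \<and> 0 \<le> Re (f x))"

definition strictly_pos_fun :: "'a measure \<Rightarrow> ('a \<Rightarrow> complex) \<Rightarrow> bool" where
  "strictly_pos_fun M f \<longleftrightarrow> (AE x in M. Im (f x) = 0 \<and> 0 < Re (f x))"

definition positivity_preserving :: "'a measure \<Rightarrow> (('a \<Rightarrow> complex) \<Rightarrow> ('a \<Rightarrow> complex)) \<Rightarrow> bool" where
  "positivity_preserving M A \<longleftrightarrow> (\<forall>f\<in>L2 M. nonneg_fun M f \<longrightarrow> nonneg_fun M (A f))"

definition positivity_improving :: "'a measure \<Rightarrow> (('a \<Rightarrow> complex) \<Rightarrow> ('a \<Rightarrow> complex)) \<Rightarrow> bool" where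
  "positivity_improving M A \<longleftrightarrow>
     (\<forall>f\<in>L2 M. nonneg_fun M f \<and> \<not> ae_eq M f (\<lambda>x. 0) \<longrightarrow> strictly_pos_fun M (A f))"

end

theory Submission
  imports Defs "HOL-Library.Function_Algebras"
begin

text \<open>Write \<open>m\<close> for the infimum of \<open>\<langle>f, K f\<rangle> / \<parallel>f\<parallel>\<^sup>2\<close> over the domain; it equals \<open>inf \<sigma>(K)\<close> and, after a shift, \<open>m = 0\<close>, so that the
  semigroup is a symmetric contraction semigroup and \<open>\<langle>\<psi>, T t \<psi>\<rangle> = \<parallel>T (t/2) \<psi>\<parallel>\<^sup>2\<close> stays bounded. Conversely, suppose
  \<open>\<parallel>T t \<psi>\<parallel> < exp (- \<epsilon> t)\<close> for arbitrarily large \<open>t\<close>. Positivity carries this over to every \<open>f\<close> dominated by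
  a multiple of \<open>T \<tau> \<psi> > 0\<close>, and \<open>\<parallel>T t f\<parallel>\<^sup>2 \<le> \<parallel>f\<parallel> \<parallel>T (2t) f\<parallel>\<close> turns decay at infinity into
  \<open>\<parallel>T t f\<parallel> \<le> exp (- \<epsilon> t / 2) \<parallel>f\<parallel>\<close> for all \<open>t\<close>. Such \<open>f\<close> are dense because \<open>T \<tau> \<psi>\<close> is strictly positive, so the
  bound holds for all \<open>f\<close>; differentiating at \<open>t = 0\<close> gives \<open>\<langle>f, K f\<rangle> \<ge> \<epsilon>/2 \<parallel>f\<parallel>\<^sup>2\<close>, which contradicts \<open>m = 0\<close>.\<close>

section \<open>The seminormed space of square-integrable functions\<close>

text \<open>No spectral measure or functional calculus enters. \<open>generates_semigroup\<close>
  ties \<open>T\<close> to \<open>K\<close> only through right difference quotients at 0 and grants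
  each \<open>T t\<close> its own norm bound. Three facts usually read off the spectral theorem must
  therefore be recovered: a bound uniform for small times (its failure would produce, by a gliding
  hump, one vector whose orbit is unbounded near 0), symmetry of \<open>T t\<close>, and
  contractivity when the form of \<open>K\<close> is nonnegative. The last two come from cutting the
  time interval into n pieces and summing errors of size o(1/n). The spectrum is defined through
  invertibility, so its comparison with the form needs two arguments: a strictly positive form bound
  makes \<open>K - r\<close> invertible, and invertibility at \<open>m\<close> would improve the
  optimal bound \<open>m\<close>. Elements of \<open>L2 M\<close> are functions, not classes:
  operators are linear only up to \<open>ae_eq\<close>, and most identities are passed through the
  seminorm. \<open>scl\<close> complements the pointwise \<open>+\<close> and \<open>-\<close>, so
  that exact linear identities reduce to pointwise ones.\<close>

definition scl :: "complex \<Rightarrow> ('a \<Rightarrow> complex) \<Rightarrow> 'a \<Rightarrow> complex" where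
  "scl c f = (\<lambda>x. c * f x)"

lemma scl_apply [simp]: "scl c f x = c * f x"
  by (simp add: scl_def)

lemma scl_scl [simp]: "scl a (scl b f) = scl (a * b) f"
  by (auto simp: fun_eq_iff)

lemma scl_1 [simp]: "scl 1 f = f"
  by (auto simp: fun_eq_iff)

lemma L2I: "f \<in> borel_measurable M \<Longrightarrow> integrable M (\<lambda>x. (cmod (f x))^2) \<Longrightarrow> f \<in> L2 M"
  by (simp add: L2_def)

lemma L2_measurable: "f \<in> L2 M \<Longrightarrow> f \<in> borel_measurable M"
  by (simp add: L2_def)

lemma L2_integrable: "f \<in> L2 M \<Longrightarrow> integrable M (\<lambda>x. (cmod (f x))^2)"
  by (simp add: L2_def)

lemma L2_zero [simp]: "0 \<in> L2 M"
  by (simp add: L2_def zero_fun_def)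

lemma L2_scl [simp]:
  assumes "f \<in> L2 M" shows "scl c f \<in> L2 M"
  using assms by (auto simp: L2_def scl_def norm_mult power_mult_distrib)

lemma cmod_add_power2_le: "(cmod (a + b))\<^sup>2 \<le> 2 * (cmod a)\<^sup>2 + 2 * (cmod b)\<^sup>2"
proof -
  have "(cmod (a + b))\<^sup>2 \<le> (cmod a + cmod b)\<^sup>2"
    by (intro power_mono norm_triangle_ineq) auto
  also have "\<dots> \<le> 2 * (cmod a)\<^sup>2 + 2 * (cmod b)\<^sup>2"
    using sum_squares_bound[of "cmod a" "cmod b"] by (simp add: power2_sum)
  finally show ?thesis .
qed

lemma L2_add [simp]:
  assumes f: "f \<in> L2 M" and g: "g \<in> L2 M" shows "f + g \<in> L2 M"
proof (rule L2I)
  have [measurable]: "f \<in> borel_measurable M" "g \<in> borel_measurable M"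
    using f g by (auto dest: L2_measurable)
  show "f + g \<in> borel_measurable M" by (simp add: plus_fun_def)
  show "integrable M (\<lambda>x. (cmod ((f + g) x))\<^sup>2)"
  proof (rule Bochner_Integration.integrable_bound)
    show "integrable M (\<lambda>x. 2 * (cmod (f x))\<^sup>2 + 2 * (cmod (g x))\<^sup>2)"
      using L2_integrable[OF f] L2_integrable[OF g] by simp
    show "AE x in M. norm ((cmod ((f + g) x))\<^sup>2) \<le> norm (2 * (cmod (f x))\<^sup>2 + 2 * (cmod (g x))\<^sup>2)"
      using cmod_add_power2_le by auto
  qed simp
qed

lemma diff_eq_add_scl: "f - g = f + scl (-1) g"
  by (auto simp: fun_eq_iff)

lemma diff_scl_minus_1 [simp]: "f - scl (-1) g = f + g"
  by (auto simp: fun_eq_iff)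

lemma L2_diff [simp]: "f \<in> L2 M \<Longrightarrow> g \<in> L2 M \<Longrightarrow> f - g \<in> L2 M"
  by (simp add: diff_eq_add_scl)

lemma L2_cong_bound:
  assumes g: "g \<in> L2 M" and [measurable]: "f \<in> borel_measurable M"
    and le: "AE x in M. cmod (f x) \<le> cmod (g x)"
  shows "f \<in> L2 M"
proof (rule L2I)
  show "integrable M (\<lambda>x. (cmod (f x))\<^sup>2)"
  proof (rule Bochner_Integration.integrable_bound[OF L2_integrable[OF g]])
    show "AE x in M. norm ((cmod (f x))\<^sup>2) \<le> norm ((cmod (g x))\<^sup>2)"
      using le by eventually_elim (simp add: power_mono)
  qed simp
qed simp

lemma borel_measurable_cnj [measurable (raw)]:
  "f \<in> borel_measurable M \<Longrightarrow> (\<lambda>x. cnj (f x)) \<in> borel_measurable M"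
  by (rule measurable_compose[OF _ borel_measurable_continuous_onI])
     (auto intro: continuous_on_cnj continuous_on_id)

lemma L2_inner_integrable:
  assumes f: "f \<in> L2 M" and g: "g \<in> L2 M"
  shows "integrable M (\<lambda>x. cnj (f x) * g x)"
proof (rule Bochner_Integration.integrable_bound)
  have [measurable]: "f \<in> borel_measurable M" "g \<in> borel_measurable M"
    using f g by (auto dest: L2_measurable)
  show "integrable M (\<lambda>x. (cmod (f x))\<^sup>2 + (cmod (g x))\<^sup>2)"
    using f g by (auto dest: L2_integrable)
  show "(\<lambda>x. cnj (f x) * g x) \<in> borel_measurable M" by measurable
  have "cmod (f x) * cmod (g x) \<le> (cmod (f x))\<^sup>2 + (cmod (g x))\<^sup>2" for x
    using sum_squares_bound[of "cmod (f x)" "cmod (g x)"] mult_nonneg_nonneg[OF norm_ge_zero norm_ge_zero, of "f x" "g x"]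
    by linarith
  then show "AE x in M. norm (cnj (f x) * g x) \<le> norm ((cmod (f x))\<^sup>2 + (cmod (g x))\<^sup>2)"
    by (auto simp: norm_mult)
qed

lemma L2_inner_add_right [simp]:
  "f \<in> L2 M \<Longrightarrow> g \<in> L2 M \<Longrightarrow> h \<in> L2 M \<Longrightarrow> L2_inner M f (g + h) = L2_inner M f g + L2_inner M f h"
  by (simp add: L2_inner_def distrib_left L2_inner_integrable)

lemma L2_inner_scl_right [simp]: "L2_inner M f (scl c g) = c * L2_inner M f g"
  by (simp add: L2_inner_def mult.left_commute)

lemma L2_inner_commute: "L2_inner M g f = cnj (L2_inner M f g)"
  unfolding L2_inner_def by (subst Bochner_Integration.integral_cnj [symmetric]) (simp add: mult.commute)

lemma L2_inner_add_left [simp]: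
  "f \<in> L2 M \<Longrightarrow> g \<in> L2 M \<Longrightarrow> h \<in> L2 M \<Longrightarrow> L2_inner M (f + g) h = L2_inner M f h + L2_inner M g h"
  by (metis L2_inner_add_right L2_inner_commute complex_cnj_add)

lemma L2_inner_scl_left [simp]: "L2_inner M (scl c f) g = cnj c * L2_inner M f g"
  by (metis L2_inner_scl_right L2_inner_commute complex_cnj_mult complex_cnj_cnj)

lemma L2_inner_diff_right [simp]:
  "f \<in> L2 M \<Longrightarrow> g \<in> L2 M \<Longrightarrow> h \<in> L2 M \<Longrightarrow> L2_inner M f (g - h) = L2_inner M f g - L2_inner M f h"
  by (simp add: diff_eq_add_scl)

lemma L2_inner_diff_left [simp]:
  "f \<in> L2 M \<Longrightarrow> g \<in> L2 M \<Longrightarrow> h \<in> L2 M \<Longrightarrow> L2_inner M (f - g) h = L2_inner M f h - L2_inner M g h"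
  by (simp add: diff_eq_add_scl)

lemma L2_inner_zero [simp]: "L2_inner M f 0 = 0" "L2_inner M 0 f = 0"
  by (auto simp: L2_inner_def)

lemma L2_norm_nonneg [simp]: "0 \<le> L2_norm M f"
  by (simp add: L2_norm_def)

lemma L2_inner_self: "L2_inner M f f = of_real ((L2_norm M f)\<^sup>2)"
proof -
  have "L2_inner M f f = (LINT x|M. of_real ((cmod (f x))\<^sup>2))"
    unfolding L2_inner_def
    by (intro Bochner_Integration.integral_cong) (simp_all only: complex_norm_square mult.commute)
  then show ?thesis
    by (simp only: integral_complex_of_real L2_norm_def) simp
qed

lemma L2_norm_power2: "(L2_norm M f)\<^sup>2 = Re (L2_inner M f f)"
  by (simp add: L2_inner_self)

lemma L2_norm_scl [simp]: "L2_norm M (scl c f) = cmod c * L2_norm M f"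
  by (simp add: L2_norm_def norm_mult power_mult_distrib real_sqrt_mult)

lemma L2_norm_zero [simp]: "L2_norm M 0 = 0"
  by (simp add: L2_norm_def)

lemma L2_norm_minus_commute: "L2_norm M (f - g) = L2_norm M (g - f)"
  by (simp add: L2_norm_def norm_minus_commute)

text \<open>The inequality for nonnegative integrals is applied to the moduli; integrability of all
  three integrands brings it from extended to real numbers.\<close>

lemma L2_Cauchy_Schwarz:
  assumes f: "f \<in> L2 M" and g: "g \<in> L2 M"
  shows "cmod (L2_inner M f g) \<le> L2_norm M f * L2_norm M g"
proof -
  have [measurable]: "f \<in> borel_measurable M" "g \<in> borel_measurable M"
    using f g by (auto dest: L2_measurable)
  have int: "integrable M (\<lambda>x. cmod (f x) * cmod (g x))"
    using integrable_norm[OF L2_inner_integrable[OF f g]] by (simp add: norm_mult)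
  have nn: "(\<integral>\<^sup>+x. ennreal (h x) \<partial>M) = ennreal (LINT x|M. h x)" if "integrable M h" "\<And>x. h x \<ge> 0" for h
    using that by (intro nn_integral_eq_integral) auto
  have "(\<integral>\<^sup>+x. ennreal (cmod (f x)) * ennreal (cmod (g x)) \<partial>M)\<^sup>2
      \<le> (\<integral>\<^sup>+x. (ennreal (cmod (f x)))\<^sup>2 \<partial>M) * (\<integral>\<^sup>+x. (ennreal (cmod (g x)))\<^sup>2 \<partial>M)"
    by (rule Cauchy_Schwarz_nn_integral) auto
  then have "ennreal ((LINT x|M. cmod (f x) * cmod (g x))\<^sup>2)
      \<le> ennreal ((LINT x|M. (cmod (f x))\<^sup>2) * (LINT x|M. (cmod (g x))\<^sup>2))"
    using nn[OF int] nn[OF L2_integrable[OF f]] nn[OF L2_integrable[OF g]]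
    by (simp add: ennreal_mult ennreal_power)
  then have "(LINT x|M. cmod (f x) * cmod (g x))\<^sup>2
      \<le> (LINT x|M. (cmod (f x))\<^sup>2) * (LINT x|M. (cmod (g x))\<^sup>2)"
    by (subst (asm) ennreal_le_iff) simp_all
  then have "\<bar>LINT x|M. cmod (f x) * cmod (g x)\<bar> \<le> L2_norm M f * L2_norm M g"
    unfolding L2_norm_def real_sqrt_mult[symmetric] by (rule real_le_rsqrt[OF order_trans, rotated]) simp
  moreover have "cmod (L2_inner M f g) \<le> (LINT x|M. norm (cnj (f x) * g x))"
    unfolding L2_inner_def by (rule integral_norm_bound)
  ultimately show ?thesis by (simp add: norm_mult)
qed

lemma L2_norm_add_power2:
  assumes "f \<in> L2 M" "g \<in> L2 M"
  shows "(L2_norm M (f + g))\<^sup>2 = (L2_norm M f)\<^sup>2 + 2 * Re (L2_inner M f g) + (L2_norm M g)\<^sup>2"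
  using assms by (simp add: L2_norm_power2 L2_inner_commute[of M g f])

lemma L2_norm_triangle:
  assumes "f \<in> L2 M" "g \<in> L2 M"
  shows "L2_norm M (f + g) \<le> L2_norm M f + L2_norm M g"
proof (rule power2_le_imp_le)
  show "(L2_norm M (f + g))\<^sup>2 \<le> (L2_norm M f + L2_norm M g)\<^sup>2"
    using complex_Re_le_cmod[of "L2_inner M f g"] L2_Cauchy_Schwarz[OF assms]
    by (simp add: L2_norm_add_power2[OF assms] power2_sum)
qed simp

lemma L2_norm_triangle_diff:
  assumes "f \<in> L2 M" "g \<in> L2 M"
  shows "L2_norm M f \<le> L2_norm M g + L2_norm M (f - g)"
  using L2_norm_triangle[of g M "f - g"] assms by (simp add: algebra_simps)

lemma L2_norm_diff_triangle:
  assumes "f \<in> L2 M" "g \<in> L2 M"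
  shows "L2_norm M (f - g) \<le> L2_norm M f + L2_norm M g"
  using L2_norm_triangle[of f M "scl (-1) g"] assms by (simp add: diff_eq_add_scl)

lemma ae_eq_sym: "ae_eq M f g \<Longrightarrow> ae_eq M g f"
  by (auto simp: ae_eq_def eq_commute)

lemma ae_eq_trans:
  assumes "ae_eq M f g" "ae_eq M g h" shows "ae_eq M f h"
  using assms unfolding ae_eq_def by eventually_elim simp

lemma ae_eq_refl [simp]: "ae_eq M f f"
  by (simp add: ae_eq_def)

lemma ae_eq_diff:
  assumes "ae_eq M f f'" "ae_eq M g g'" shows "ae_eq M (f - g) (f' - g')"
  using assms unfolding ae_eq_def by eventually_elim simp

lemma ae_eq_scl:
  assumes "ae_eq M f f'" shows "ae_eq M (scl c f) (scl c f')"
  using assms unfolding ae_eq_def by eventually_elim simp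

lemma L2_norm_cong:
  assumes "ae_eq M f g" "f \<in> L2 M" "g \<in> L2 M"
  shows "L2_norm M f = L2_norm M g"
proof -
  have [measurable]: "f \<in> borel_measurable M" "g \<in> borel_measurable M"
    using assms by (auto dest: L2_measurable)
  have "AE x in M. (cmod (f x))\<^sup>2 = (cmod (g x))\<^sup>2"
    using assms(1) unfolding ae_eq_def by eventually_elim simp
  then show ?thesis
    unfolding L2_norm_def by (auto intro!: integral_cong_AE)
qed

lemma L2_inner_cong:
  assumes "ae_eq M f f'" "ae_eq M g g'" "f \<in> L2 M" "g \<in> L2 M" "f' \<in> L2 M" "g' \<in> L2 M"
  shows "L2_inner M f g = L2_inner M f' g'"
proof -
  have [measurable]: "f \<in> borel_measurable M" "g \<in> borel_measurable M"
    "f' \<in> borel_measurable M" "g' \<in> borel_measurable M"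
    using assms by (auto dest: L2_measurable)
  have "AE x in M. cnj (f x) * g x = cnj (f' x) * g' x"
    using assms(1,2) unfolding ae_eq_def by eventually_elim simp
  then show ?thesis
    unfolding L2_inner_def by (auto intro!: integral_cong_AE)
qed

lemma L2_norm_eq_0_iff:
  assumes "f \<in> L2 M" shows "L2_norm M f = 0 \<longleftrightarrow> ae_eq M f 0"
  using integral_nonneg_eq_0_iff_AE[OF L2_integrable[OF assms]]
  by (auto simp: L2_norm_def ae_eq_def)

lemma ae_eq_iff_L2_norm:
  assumes "f \<in> L2 M" "g \<in> L2 M" shows "ae_eq M f g \<longleftrightarrow> L2_norm M (f - g) = 0"
  using assms by (simp add: L2_norm_eq_0_iff) (simp add: ae_eq_def)

lemma nn_integral_cmod_power2:
  assumes "f \<in> L2 M"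
  shows "(\<integral>\<^sup>+x. ennreal ((cmod (f x))\<^sup>2) \<partial>M) = ennreal ((L2_norm M f)\<^sup>2)"
  using nn_integral_eq_integral[OF L2_integrable[OF assms]] by (simp add: L2_norm_def)

lemma L2_norm_mono:
  assumes f: "f \<in> L2 M" and g: "g \<in> L2 M" and le: "AE x in M. cmod (f x) \<le> cmod (g x)"
  shows "L2_norm M f \<le> L2_norm M g"
  unfolding L2_norm_def real_sqrt_le_iff
proof (rule integral_mono_AE[OF L2_integrable[OF f] L2_integrable[OF g]])
  show "AE x in M. (cmod (f x))\<^sup>2 \<le> (cmod (g x))\<^sup>2"
    using le by eventually_elim (simp add: power_mono)
qed

text \<open>Fatou's lemma bounds the nonnegative integral of a limit whose integrability is still
  open; this turns such a bound into membership in \<open>L2 M\<close>.\<close>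

lemma L2_if_nn_integral_le:
  assumes [measurable]: "f \<in> borel_measurable M" and "0 \<le> c"
    and le: "(\<integral>\<^sup>+x. ennreal ((cmod (f x))\<^sup>2) \<partial>M) \<le> ennreal (c\<^sup>2)"
  shows "f \<in> L2 M" "L2_norm M f \<le> c"
proof -
  show f: "f \<in> L2 M"
  proof (rule L2I)
    show "integrable M (\<lambda>x. (cmod (f x))\<^sup>2)"
      using le by (intro integrableI_nonneg) (auto intro: le_less_trans)
  qed simp
  show "L2_norm M f \<le> c"
    using le \<open>0 \<le> c\<close> by (auto simp: nn_integral_cmod_power2[OF f] intro: power2_le_imp_le)
qed

lemma L2_sum [simp]: "(\<And>i. i \<in> I \<Longrightarrow> f i \<in> L2 M) \<Longrightarrow> (\<Sum>i\<in>I. f i) \<in> L2 M"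
  by (induction I rule: infinite_finite_induct) auto

lemma L2_norm_sum_le:
  "(\<And>i. i \<in> I \<Longrightarrow> f i \<in> L2 M) \<Longrightarrow> L2_norm M (\<Sum>i\<in>I. f i) \<le> (\<Sum>i\<in>I. L2_norm M (f i))"
proof (induction I rule: infinite_finite_induct)
  case (insert i I)
  have "L2_norm M (\<Sum>i\<in>insert i I. f i) = L2_norm M (f i + (\<Sum>i\<in>I. f i))"
    using insert.hyps by (subst sum.insert) auto
  also have "\<dots> \<le> L2_norm M (f i) + L2_norm M (\<Sum>i\<in>I. f i)"
    using insert.prems by (intro L2_norm_triangle L2_sum) auto
  also have "\<dots> \<le> L2_norm M (f i) + (\<Sum>i\<in>I. L2_norm M (f i))"
    using insert.prems by (intro add_left_mono insert.IH) auto
  also have "\<dots> = (\<Sum>i\<in>insert i I. L2_norm M (f i))"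
    using insert.hyps by simp
  finally show ?case .
qed auto

section \<open>Completeness and the gliding hump\<close>

lemma sum_geometric_le:
  fixes q :: real
  assumes "0 < q" "q < 1"
  shows "(\<Sum>k<n. q ^ k) \<le> 1 / (1 - q)"
proof -
  have "(\<Sum>k<n. q ^ k) \<le> (\<Sum>k. q ^ k)"
    using assms by (intro sum_le_suminf summable_geometric) auto
  then show ?thesis using assms by (simp add: suminf_geometric)
qed

text \<open>The moduli of the increments have partial sums bounded in norm, so by monotone
  convergence they are summable almost everywhere and the telescoping series converges there.
  Fatou's lemma on the tails gives the explicit rate. Both limits built later have geometric
  increments, with ratios 1/3 and 1/2, and the gliding hump needs the rate itself.\<close>

lemma L2_complete_geometric:
  assumes f: "\<And>n. f n \<in> L2 M" and q: "0 < q" "q < 1" and c: "0 \<le> c"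
    and le: "\<And>n. L2_norm M (f (Suc n) - f n) \<le> c * q ^ n"
  obtains g where "g \<in> L2 M" "\<And>n. L2_norm M (g - f n) \<le> c * q ^ n / (1 - q)"
proof -
  have [measurable]: "f n \<in> borel_measurable M" for n
    using f by (rule L2_measurable)
  define d where "d n = (\<lambda>x. complex_of_real (cmod (f (Suc n) x - f n x)))" for n
  have d [simp]: "d n \<in> L2 M" for n
    by (rule L2_cong_bound[of "f (Suc n) - f n"]) (use f in \<open>auto simp: d_def\<close>)
  have Nd: "L2_norm M (d n) \<le> c * q ^ n" for n
    using le[of n] by (simp add: d_def L2_norm_def)
  define G where "G n = (\<Sum>k<n. d k)" for n
  have G [simp]: "G n \<in> L2 M" for n
    by (simp add: G_def)
  have [measurable]: "G n \<in> borel_measurable M" for n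
    using G by (rule L2_measurable)
  have G_apply: "G n x = of_real (\<Sum>k<n. cmod (f (Suc k) x - f k x))" for n x
    by (induction n) (simp_all add: G_def d_def)
  have cmod_G: "cmod (G n x) = (\<Sum>k<n. cmod (f (Suc k) x - f k x))" for n x
    unfolding G_apply norm_of_real by (simp add: sum_nonneg)
  have NG: "L2_norm M (G n) \<le> c / (1 - q)" for n
  proof -
    have "L2_norm M (G n) \<le> (\<Sum>k<n. c * q ^ k)"
      unfolding G_def by (rule order_trans[OF L2_norm_sum_le sum_mono]) (auto intro: Nd)
    also have "\<dots> \<le> c * (1 / (1 - q))"
      unfolding sum_distrib_left[symmetric] using c q by (intro mult_left_mono sum_geometric_le) auto
    finally show ?thesis by simp
  qed
  have "(\<integral>\<^sup>+x. (SUP n. ennreal ((cmod (G n x))\<^sup>2)) \<partial>M) = (SUP n. \<integral>\<^sup>+x. ennreal ((cmod (G n x))\<^sup>2) \<partial>M)"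
  proof (rule nn_integral_monotone_convergence_SUP)
    show "incseq (\<lambda>n x. ennreal ((cmod (G n x))\<^sup>2))"
      unfolding cmod_G
      by (intro incseq_SucI le_funI ennreal_leI power_mono sum_nonneg) auto
  qed simp
  also have "\<dots> \<le> ennreal ((c / (1 - q))\<^sup>2)"
    by (intro SUP_least) (auto simp: nn_integral_cmod_power2 intro!: ennreal_leI power_mono NG)
  finally have "(\<integral>\<^sup>+x. (SUP n. ennreal ((cmod (G n x))\<^sup>2)) \<partial>M) \<noteq> \<infinity>"
    by (auto simp: top_unique)
  then have "AE x in M. (SUP n. ennreal ((cmod (G n x))\<^sup>2)) \<noteq> \<infinity>"
    by (intro nn_integral_PInf_AE) auto
  then have conv: "AE x in M. (\<lambda>n. f n x) \<longlonglongrightarrow> lim (\<lambda>n. f n x)"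
  proof eventually_elim
    fix x assume fin: "(SUP n. ennreal ((cmod (G n x))\<^sup>2)) \<noteq> \<infinity>"
    then obtain b where b: "(SUP n. ennreal ((cmod (G n x))\<^sup>2)) = ennreal b" "0 \<le> b"
      by (metis ennreal_cases infinity_ennreal_def)
    have "(\<Sum>k<n. cmod (f (Suc k) x - f k x)) \<le> sqrt b" for n
    proof -
      have "ennreal ((cmod (G n x))\<^sup>2) \<le> ennreal b"
        unfolding b(1)[symmetric] by (rule SUP_upper) simp
      then show ?thesis
        unfolding cmod_G[symmetric] using b(2) by (intro real_le_rsqrt) simp
    qed
    then have "summable (\<lambda>k. f (Suc k) x - f k x)"
      by (intro summable_norm_cancel[OF summableI_nonneg_bounded]) auto
    then have "(\<lambda>n. (\<Sum>k<n. f (Suc k) x - f k x) + f 0 x) \<longlonglongrightarrow> (\<Sum>k. f (Suc k) x - f k x) + f 0 x"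
      by (intro tendsto_add tendsto_const summable_LIMSEQ)
    then have "convergent (\<lambda>n. f n x)"
      using sum_lessThan_telescope[of "\<lambda>k. f k x"] by (auto simp: convergent_def)
    then show "(\<lambda>n. f n x) \<longlonglongrightarrow> lim (\<lambda>n. f n x)"
      by (simp add: convergent_LIMSEQ_iff)
  qed
  \<comment> \<open>\<open>lim\<close> is total, so \<open>g\<close> is measurable as it stands; its
    values on the null set without convergence do not matter.\<close>
  define g where "g = (\<lambda>x. lim (\<lambda>n. f n x))"
  have [measurable]: "g \<in> borel_measurable M"
    unfolding g_def by (rule borel_measurable_lim_metric) simp
  have tail: "L2_norm M (f (k + n) - f n) \<le> c * q ^ n / (1 - q)" for k n
  proof -
    have "f (k + n) - f n = (\<Sum>i<k. f (Suc (i + n)) - f (i + n))"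
      using sum_lessThan_telescope[of "\<lambda>i. f (i + n)" k] by simp
    then have "L2_norm M (f (k + n) - f n) \<le> (\<Sum>i<k. L2_norm M (f (Suc (i + n)) - f (i + n)))"
      using f by (auto intro: L2_norm_sum_le)
    also have "\<dots> \<le> (\<Sum>i<k. c * q ^ n * q ^ i)"
      by (intro sum_mono order_trans[OF le]) (simp add: power_add mult_ac)
    also have "\<dots> \<le> c * q ^ n * (1 / (1 - q))"
      unfolding sum_distrib_left[symmetric] using c q by (intro mult_left_mono sum_geometric_le) auto
    finally show ?thesis by simp
  qed
  have gf: "g - f n \<in> L2 M \<and> L2_norm M (g - f n) \<le> c * q ^ n / (1 - q)" for n
  proof -
    have "(\<integral>\<^sup>+x. ennreal ((cmod ((g - f n) x))\<^sup>2) \<partial>M)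
        = (\<integral>\<^sup>+x. liminf (\<lambda>k. ennreal ((cmod ((f (k + n) - f n) x))\<^sup>2)) \<partial>M)"
    proof (rule nn_integral_cong_AE, use conv in eventually_elim)
      fix x assume "(\<lambda>n. f n x) \<longlonglongrightarrow> lim (\<lambda>n. f n x)"
      then have "(\<lambda>k. f (k + n) x) \<longlonglongrightarrow> g x"
        unfolding g_def by (rule LIMSEQ_ignore_initial_segment)
      then have "(\<lambda>k. ennreal ((cmod (f (k + n) x - f n x))\<^sup>2)) \<longlonglongrightarrow> ennreal ((cmod (g x - f n x))\<^sup>2)"
        by (intro tendsto_ennrealI tendsto_intros)
      from lim_imp_Liminf[OF sequentially_bot this]
      show "ennreal ((cmod ((g - f n) x))\<^sup>2) = liminf (\<lambda>k. ennreal ((cmod ((f (k + n) - f n) x))\<^sup>2))"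
        by (simp only: minus_apply)
    qed
    also have "\<dots> \<le> liminf (\<lambda>k. \<integral>\<^sup>+x. ennreal ((cmod ((f (k + n) - f n) x))\<^sup>2) \<partial>M)"
      by (rule nn_integral_liminf) simp
    also have "\<dots> \<le> liminf (\<lambda>k::nat. ennreal ((c * q ^ n / (1 - q))\<^sup>2))"
      by (intro Liminf_mono always_eventually allI)
         (use f tail in \<open>auto simp: nn_integral_cmod_power2 simp del: minus_apply intro!: ennreal_leI power_mono\<close>)
    also have "\<dots> = ennreal ((c * q ^ n / (1 - q))\<^sup>2)"
      by (simp add: Liminf_const)
    finally show ?thesis
      using c q by (intro conjI L2_if_nn_integral_le) (simp_all add: fun_diff_def)
  qed
  have "g = (g - f 0) + f 0" by simp
  then have "g \<in> L2 M" using gf[of 0] f[of 0] by (metis L2_add)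
  then show thesis using gf by (intro that) auto
qed

section \<open>Operator norms and uniform boundedness along a sequence\<close>

lemma L2_bounded_opD:
  assumes "L2_bounded_op M A"
  shows L2_bounded_op_L2: "f \<in> L2 M \<Longrightarrow> A f \<in> L2 M"
    and L2_bounded_op_cong: "f \<in> L2 M \<Longrightarrow> g \<in> L2 M \<Longrightarrow> ae_eq M f g \<Longrightarrow> ae_eq M (A f) (A g)"
    and L2_bounded_op_add: "f \<in> L2 M \<Longrightarrow> g \<in> L2 M \<Longrightarrow> ae_eq M (A (f + g)) (A f + A g)"
    and L2_bounded_op_diff: "f \<in> L2 M \<Longrightarrow> g \<in> L2 M \<Longrightarrow> ae_eq M (A (f - g)) (A f - A g)"
    and L2_bounded_op_scl: "f \<in> L2 M \<Longrightarrow> ae_eq M (A (scl c f)) (scl c (A f))"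
proof -
  have lin: "ae_eq M (A (scl a f + scl b g)) (scl a (A f) + scl b (A g))" if "f \<in> L2 M" "g \<in> L2 M" for a b f g
    using assms that by (simp add: L2_bounded_op_def plus_fun_def scl_def)
  show "f \<in> L2 M \<Longrightarrow> g \<in> L2 M \<Longrightarrow> ae_eq M (A (f + g)) (A f + A g)"
    using lin[of f g 1 1] by simp
  show "f \<in> L2 M \<Longrightarrow> g \<in> L2 M \<Longrightarrow> ae_eq M (A (f - g)) (A f - A g)"
    using lin[of f g 1 "-1"] by (simp add: diff_eq_add_scl)
  have "scl 0 g = 0" for g :: "'a \<Rightarrow> complex" by (simp add: fun_eq_iff)
  then show "f \<in> L2 M \<Longrightarrow> ae_eq M (A (scl c f)) (scl c (A f))"
    using lin[of f f c 0] by simp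
qed (use assms in \<open>auto simp: L2_bounded_op_def\<close>)

text \<open>\<open>b\<close> is the operator norm. The supremum runs over the unit ball, which
  contains 0 even if every element has norm zero. Any factor below 1 would yield some \<xi>; 3/4
  exceeds the 1/2 that the tail of the gliding hump takes away.\<close>

lemma L2_bounded_op_near_norm:
  assumes A: "L2_bounded_op M A"
  obtains b \<xi> where "0 \<le> b" "\<And>f. f \<in> L2 M \<Longrightarrow> L2_norm M (A f) \<le> b * L2_norm M f"
    "\<xi> \<in> L2 M" "L2_norm M \<xi> \<le> 1" "3 / 4 * b \<le> L2_norm M (A \<xi>)"
proof -
  note AL = L2_bounded_op_L2[OF A]
  obtain C where C: "\<And>f. f \<in> L2 M \<Longrightarrow> L2_norm M (A f) \<le> C * L2_norm M f"
    using A unfolding L2_bounded_op_def by blast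
  define S where "S = {L2_norm M (A f) | f. f \<in> L2 M \<and> L2_norm M f \<le> 1}"
  have bdd: "bdd_above S"
  proof (rule bdd_aboveI[of _ "\<bar>C\<bar>"])
    fix s assume "s \<in> S"
    then obtain f where f: "f \<in> L2 M" "L2_norm M f \<le> 1" "s = L2_norm M (A f)" by (auto simp: S_def)
    have "s \<le> \<bar>C\<bar> * L2_norm M f" using C[OF f(1)] f(3)
      by (meson L2_norm_nonneg abs_ge_self mult_right_mono order_trans)
    also have "\<dots> \<le> \<bar>C\<bar>" using f(2) by (simp add: mult_left_le)
    finally show "s \<le> \<bar>C\<bar>" .
  qed
  have A0: "L2_norm M (A 0) = 0" using C[of 0] L2_norm_nonneg[of M "A 0"] by simp
  have S0: "0 \<in> S" unfolding S_def using A0 by (auto intro!: exI[of _ 0])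
  define b where "b = Sup S"
  have b0: "0 \<le> b" unfolding b_def by (rule cSup_upper[OF S0 bdd])
  have bound: "L2_norm M (A f) \<le> b * L2_norm M f" if f: "f \<in> L2 M" for f
  proof (cases "L2_norm M f = 0")
    case True
    then show ?thesis using C[OF f] by simp
  next
    case False
    let ?g = "scl (of_real (inverse (L2_norm M f))) f"
    have "L2_norm M (A ?g) \<le> b"
      unfolding b_def by (rule cSup_upper[OF _ bdd]) (use f False in \<open>auto simp: S_def norm_inverse intro!: exI[of _ ?g]\<close>)
    moreover have "L2_norm M (A ?g) = L2_norm M (scl (of_real (inverse (L2_norm M f))) (A f))"
      using f by (intro L2_norm_cong L2_bounded_op_scl[OF A] AL L2_scl)
    ultimately have "inverse (L2_norm M f) * L2_norm M (A f) \<le> b"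
      by (simp add: norm_inverse)
    then show ?thesis
      using False L2_norm_nonneg[of M f] by (simp add: field_simps)
  qed
  have "\<exists>s\<in>S. 3 / 4 * b \<le> s"
  proof (cases "b = 0")
    case False
    then have "3 / 4 * b < Sup S" using b0 b_def by simp
    then show ?thesis using less_cSup_iff[OF _ bdd] S0 by (metis empty_iff less_imp_le)
  qed (use S0 in auto)
  then show thesis using b0 bound by (auto simp: S_def intro: that)
qed

text \<open>The images for the signs plus and minus differ by \<open>2 r A \<xi>\<close>, so they
  cannot both have norm below \<open>r \<parallel>A \<xi>\<parallel>\<close>.\<close>

lemma L2_gliding_step:
  assumes A: "L2_bounded_op M A" and f: "f \<in> L2 M" and xi: "\<xi> \<in> L2 M"
  obtains s where "cmod s = 1" "r * L2_norm M (A \<xi>) \<le> L2_norm M (A (f + scl (s * of_real r) \<xi>))"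
proof -
  note AL = L2_bounded_op_L2[OF A]
  let ?g = "f + scl (of_real r) \<xi>" and ?h = "f + scl (-1 * of_real r) \<xi>"
  have gh: "?g - ?h = scl (of_real (2 * r)) \<xi>" by (auto simp: fun_eq_iff algebra_simps)
  have "2 * r * L2_norm M (A \<xi>) \<le> L2_norm M (scl (of_real (2 * r)) (A \<xi>))"
    by (simp add: mult_right_mono norm_mult)
  also have "\<dots> = L2_norm M (A (?g - ?h))"
    unfolding gh using xi by (intro L2_norm_cong ae_eq_sym[OF L2_bounded_op_scl[OF A]] AL L2_scl)
  also have "\<dots> = L2_norm M (A ?g - A ?h)"
    using xi f by (intro L2_norm_cong L2_bounded_op_diff[OF A] AL L2_scl L2_add L2_diff)
  also have "\<dots> \<le> L2_norm M (A ?g) + L2_norm M (A ?h)"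
    using xi f by (intro L2_norm_diff_triangle AL L2_add L2_scl)
  finally have "r * L2_norm M (A \<xi>) \<le> L2_norm M (A ?g) \<or> r * L2_norm M (A \<xi>) \<le> L2_norm M (A ?h)"
    by linarith
  then show thesis
    using that[of 1] that[of "-1"] by auto
qed

text \<open>Gliding hump: along \<open>x\<^sub>n\<^sub>+\<^sub>1 = x\<^sub>n \<plusminus> 3\<^sup>-\<^sup>n \<xi>\<^sub>n\<close>, with \<open>\<xi>\<^sub>n\<close> almost norming \<open>A\<^sub>n\<close>, the later corrections
  cannot destroy the size of \<open>A\<^sub>n x\<^sub>n\<^sub>+\<^sub>1\<close>.\<close>
lemma L2_gliding_hump:
  assumes A: "\<And>n. L2_bounded_op M (A n)"
    and big: "\<And>n::nat. \<exists>f\<in>L2 M. 4 ^ n * L2_norm M f < L2_norm M (A n f)"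
  obtains x where "x \<in> L2 M" "\<And>n. (4 / 3) ^ n / 4 \<le> L2_norm M (A n x)"
proof -
  note AL = L2_bounded_op_L2[OF A]
  have "\<exists>b \<xi>. 0 \<le> b \<and> (\<forall>f\<in>L2 M. L2_norm M (A n f) \<le> b * L2_norm M f) \<and>
    \<xi> \<in> L2 M \<and> L2_norm M \<xi> \<le> 1 \<and> 3 / 4 * b \<le> L2_norm M (A n \<xi>)" for n
    using L2_bounded_op_near_norm[OF A[of n]] by metis
  then obtain b \<xi> where b: "\<And>n. 0 \<le> b n" "\<And>n f. f \<in> L2 M \<Longrightarrow> L2_norm M (A n f) \<le> b n * L2_norm M f"
    and xi: "\<And>n. \<xi> n \<in> L2 M" "\<And>n. L2_norm M (\<xi> n) \<le> 1" "\<And>n. 3 / 4 * b n \<le> L2_norm M (A n (\<xi> n))"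
    by metis
  have b4: "4 ^ n \<le> b n" for n
  proof -
    obtain f where f: "f \<in> L2 M" "4 ^ n * L2_norm M f < L2_norm M (A n f)" using big by blast
    then have *: "4 ^ n * L2_norm M f < b n * L2_norm M f" using b(2)[OF f(1), of n] by linarith
    then show ?thesis using L2_norm_nonneg[of M f] by (meson linorder_not_less mult_right_mono order.strict_implies_order)
  qed
  have "\<exists>y. \<forall>n. y n \<in> L2 M \<and> (L2_norm M (y (Suc n) - y n) \<le> (1 / 3) ^ n \<and>
      (1 / 3) ^ n * (3 / 4 * b n) \<le> L2_norm M (A n (y (Suc n))))"
  proof (rule dependent_nat_choice)
    show "\<exists>x. x \<in> L2 M" using L2_zero by blast
    fix x n assume x: "x \<in> L2 M"
    obtain s where s: "cmod s = 1"
      "(1 / 3) ^ n * L2_norm M (A n (\<xi> n)) \<le> L2_norm M (A n (x + scl (s * of_real ((1 / 3) ^ n)) (\<xi> n)))"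
      using L2_gliding_step[OF A x xi(1)] by blast
    let ?y = "x + scl (s * of_real ((1 / 3) ^ n)) (\<xi> n)"
    have "?y \<in> L2 M" using x xi by simp
    moreover have "L2_norm M (?y - x) \<le> (1 / 3) ^ n"
      using s(1) xi(2)[of n] by (simp add: norm_mult norm_power norm_divide divide_le_cancel)
    moreover have "(1 / 3) ^ n * (3 / 4 * b n) \<le> L2_norm M (A n ?y)"
      by (rule order_trans[OF mult_left_mono[OF xi(3)] s(2)]) simp
    ultimately show "\<exists>y. y \<in> L2 M \<and> (L2_norm M (y - x) \<le> (1 / 3) ^ n \<and>
      (1 / 3) ^ n * (3 / 4 * b n) \<le> L2_norm M (A n y))"
      by blast
  qed
  then obtain y where y: "\<And>n. y n \<in> L2 M" "\<And>n. L2_norm M (y (Suc n) - y n) \<le> (1 / 3) ^ n"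
    "\<And>n. (1 / 3) ^ n * (3 / 4 * b n) \<le> L2_norm M (A n (y (Suc n)))"
    by blast
  obtain x where x: "x \<in> L2 M" "\<And>n. L2_norm M (x - y n) \<le> 1 * (1 / 3) ^ n / (1 - 1 / 3)"
    using L2_complete_geometric[of y M "1/3" 1] y(1,2) by auto
  have "(4 / 3) ^ n / 4 \<le> L2_norm M (A n x)" for n
  proof -
    have "L2_norm M (A n (y (Suc n))) \<le> L2_norm M (A n x) + L2_norm M (A n (y (Suc n)) - A n x)"
      by (intro L2_norm_triangle_diff AL y x)
    also have "L2_norm M (A n (y (Suc n)) - A n x) = L2_norm M (A n (y (Suc n) - x))"
      by (intro L2_norm_cong ae_eq_sym[OF L2_bounded_op_diff[OF A]] L2_diff AL y x)
    also have "\<dots> \<le> b n * L2_norm M (y (Suc n) - x)"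
      by (intro b L2_diff y x)
    \<comment> \<open>The tail after step n is at most
      \<open>(1/3)^(n+1) / (2/3) = (1/3)^n / 2\<close>. Against the gain
      \<open>3/4 * (1/3)^n\<close> it leaves a quarter of \<open>(1/3)^n * b n\<close>, and
      \<open>b n\<close> is at least \<open>4^n\<close>.\<close>
    also have "\<dots> \<le> b n * ((1 / 3) ^ n / 2)"
      using x(2)[of "Suc n"] by (intro mult_left_mono b) (simp add: L2_norm_minus_commute)
    finally have "(1 / 3) ^ n * b n / 4 \<le> L2_norm M (A n x)"
      using y(3)[of n] by (simp add: algebra_simps)
    moreover have "(4 / 3) ^ n \<le> (1 / 3) ^ n * b n"
      using b4[of n] by (simp add: power_divide divide_right_mono)
    ultimately show ?thesis by linarith
  qed
  then show thesis using that x(1) by blast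
qed

section \<open>Self-adjoint operators and the bottom of the spectrum\<close>

lemma L2_operatorD:
  assumes "L2_operator M D K"
  shows L2_operator_dom: "f \<in> D \<Longrightarrow> f \<in> L2 M"
    and L2_operator_L2: "f \<in> D \<Longrightarrow> K f \<in> L2 M"
    and L2_operator_zero: "0 \<in> D"
    and L2_operator_cong: "f \<in> D \<Longrightarrow> g \<in> L2 M \<Longrightarrow> ae_eq M f g \<Longrightarrow> g \<in> D \<and> ae_eq M (K f) (K g)"
    and L2_operator_lin_dom: "f \<in> D \<Longrightarrow> g \<in> D \<Longrightarrow> scl a f + scl b g \<in> D"
    and L2_operator_lin: "f \<in> D \<Longrightarrow> g \<in> D \<Longrightarrow> ae_eq M (K (scl a f + scl b g)) (scl a (K f) + scl b (K g))"
  using assms by (auto simp: L2_operator_def plus_fun_def scl_def zero_fun_def)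

lemma L2_self_adjointD:
  assumes "L2_self_adjoint M D K"
  shows L2_self_adjoint_operator: "L2_operator M D K"
    and L2_self_adjoint_dense: "f \<in> L2 M \<Longrightarrow> 0 < e \<Longrightarrow> \<exists>g\<in>D. L2_norm M (f - g) < e"
    and L2_self_adjoint_domI: "g \<in> L2 M \<Longrightarrow> h \<in> L2 M \<Longrightarrow>
      (\<And>f. f \<in> D \<Longrightarrow> L2_inner M (K f) g = L2_inner M f h) \<Longrightarrow> g \<in> D"
    and L2_self_adjoint_sym: "f \<in> D \<Longrightarrow> g \<in> D \<Longrightarrow> L2_inner M (K f) g = L2_inner M f (K g)"
  using assms by (auto simp: L2_self_adjoint_def fun_diff_def)

text \<open>Shifting by the form bound \<open>m\<close> makes the form nonnegative; shifting by a
  smaller real number makes it coercive.\<close>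

definition shift_op :: "real \<Rightarrow> (('a \<Rightarrow> complex) \<Rightarrow> 'a \<Rightarrow> complex) \<Rightarrow> ('a \<Rightarrow> complex) \<Rightarrow> 'a \<Rightarrow> complex" where
  "shift_op r K f = K f - scl (of_real r) f"

lemma L2_operator_shift:
  assumes K: "L2_operator M D K"
  shows "L2_operator M D (shift_op r K)"
proof -
  note KD = L2_operatorD[OF K]
  show ?thesis
    unfolding L2_operator_def
  proof (intro conjI ballI impI allI)
    show "D \<subseteq> L2 M" using KD(1) by auto
    show "(\<lambda>x. 0) \<in> D" using KD(3) by (simp add: zero_fun_def)
    show "g \<in> D" if "f \<in> D" "g \<in> L2 M" "ae_eq M f g" for f g
      using KD(4) that by blast
    show "ae_eq M (shift_op r K f) (shift_op r K g)" if "f \<in> D" "g \<in> L2 M" "ae_eq M f g" for f g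
      unfolding shift_op_def using KD(4) that by (intro ae_eq_diff ae_eq_scl) auto
    show "shift_op r K f \<in> L2 M" if "f \<in> D" for f
      unfolding shift_op_def using KD(1,2) that by auto
    show "(\<lambda>x. a * f x + b * g x) \<in> D" if "f \<in> D" "g \<in> D" for f g a b
      using KD(5)[OF that] by (simp add: plus_fun_def)
    show "ae_eq M (shift_op r K (\<lambda>x. a * f x + b * g x)) (\<lambda>x. a * shift_op r K f x + b * shift_op r K g x)"
      if "f \<in> D" "g \<in> D" for f g a b
      using KD(6)[OF that, of a b] unfolding ae_eq_def
      by eventually_elim (simp add: shift_op_def plus_fun_def algebra_simps)
  qed
qed

text \<open>Maximality of the domain transfers because a vector \<open>h\<close> representing the
  shifted operator at \<open>g\<close> becomes \<open>h + r g\<close> for \<open>K\<close>; since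
  \<open>r\<close> is real, the scalar passes through either slot of the inner product
  unchanged.\<close>

lemma L2_self_adjoint_shift:
  assumes K: "L2_self_adjoint M D K"
  shows "L2_self_adjoint M D (shift_op r K)"
proof -
  note KS = L2_self_adjointD[OF K]
  note KD = L2_operatorD[OF KS(1)]
  have sym: "L2_inner M (shift_op r K f) g = L2_inner M f (shift_op r K g)" if "f \<in> D" "g \<in> D" for f g
    using that KD(1,2) KS(4) by (simp add: shift_op_def)
  have "g \<in> D" if "g \<in> L2 M" "h \<in> L2 M" "\<forall>f\<in>D. L2_inner M (shift_op r K f) g = L2_inner M f h" for g h
  proof (rule KS(3)[of _ "h + scl (of_real r) g"])
    fix f assume f: "f \<in> D"
    have "L2_inner M (shift_op r K f) g = L2_inner M f h"
      using that f by blast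
    then have "L2_inner M (K f) g - of_real r * L2_inner M f g = L2_inner M f h"
      using that KD(1,2)[OF f] by (simp add: shift_op_def)
    then show "L2_inner M (K f) g = L2_inner M f (h + scl (of_real r) g)"
      using that KD(1)[OF f] by (simp add: algebra_simps)
  qed (use that in auto)
  moreover have "shift_op r K g \<in> L2 M" if "g \<in> D" for g
    using that KD(1,2) by (simp add: shift_op_def)
  ultimately show ?thesis
    unfolding L2_self_adjoint_def
    using L2_operator_shift[OF KS(1), of r] sym KS(2) by (auto simp: fun_diff_def)
qed

text \<open>Symmetry makes the two cross terms complex conjugates, so their real parts merge. The
  real quadratic in \<open>s\<close> drives both the minimisation and the discriminant argument
  below.\<close>

lemma L2_form_expand:
  assumes K: "L2_self_adjoint M D K" and x: "x \<in> D" and z: "z \<in> D"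
  shows "x + scl (of_real s) z \<in> D"
    and "Re (L2_inner M (x + scl (of_real s) z) (K (x + scl (of_real s) z)))
      = Re (L2_inner M x (K x)) + 2 * s * Re (L2_inner M x (K z)) + s\<^sup>2 * Re (L2_inner M z (K z))"
proof -
  note KS = L2_self_adjointD[OF K]
  note KD = L2_operatorD[OF KS(1)]
  note [simp] = KD(1,2)[OF x] KD(1,2)[OF z]
  let ?y = "x + scl (of_real s) z"
  show y: "?y \<in> D" using KD(5)[OF x z, of 1 "of_real s"] by simp
  have "L2_inner M ?y (K ?y) = L2_inner M ?y (K x + scl (of_real s) (K z))"
    using KD(6)[OF x z, of 1 "of_real s"] KD(2)[OF y] by (intro L2_inner_cong) auto
  moreover have "Re (L2_inner M z (K x)) = Re (L2_inner M x (K z))"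
    using KS(4)[OF x z] L2_inner_commute[of M z "K x"] by simp
  ultimately show "Re (L2_inner M ?y (K ?y))
      = Re (L2_inner M x (K x)) + 2 * s * Re (L2_inner M x (K z)) + s\<^sup>2 * Re (L2_inner M z (K z))"
    by (simp add: algebra_simps power2_eq_square)
qed

lemma L2_orthogonal_dense:
  assumes dense: "\<And>e. 0 < e \<Longrightarrow> \<exists>g\<in>D. L2_norm M (u - g) < e"
    and D: "D \<subseteq> L2 M" and u: "u \<in> L2 M" and orth: "\<And>f. f \<in> D \<Longrightarrow> L2_inner M f u = 0"
  shows "L2_norm M u = 0"
proof (rule ccontr)
  assume "L2_norm M u \<noteq> 0"
  then have pos: "0 < L2_norm M u" using L2_norm_nonneg[of M u] by linarith
  then obtain g where g: "g \<in> D" "L2_norm M (u - g) < L2_norm M u" using dense by blast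
  have "(L2_norm M u)\<^sup>2 = cmod (L2_inner M (u - g) u)"
    using g u D orth[OF g(1)] by (subst L2_inner_diff_left) (auto simp: L2_inner_self norm_power)
  also have "\<dots> \<le> L2_norm M (u - g) * L2_norm M u"
    using g u D by (intro L2_Cauchy_Schwarz) auto
  also have "\<dots> < L2_norm M u * L2_norm M u"
    using g(2) pos by (intro mult_strict_right_mono)
  finally show False by (simp add: power2_eq_square)
qed

lemma linear_part_eq_0:
  fixes e a :: real
  assumes "\<And>s. 0 \<le> 2 * s * e + s\<^sup>2 * a" "0 \<le> a"
  shows "e = 0"
proof (rule ccontr)
  assume "e \<noteq> 0"
  \<comment> \<open>The quadratic has its minimum at \<open>- e / a\<close>; the denominator
    \<open>a + 1\<close> keeps the witness meaningful for \<open>a = 0\<close> and still makes the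
    value negative.\<close>
  define s where "s = - e / (a + 1)"
  have "a + 1 \<noteq> 0" using assms(2) by simp
  then have "s * (a + 1) = - e" by (simp add: s_def)
  then have e: "e = - (s * (a + 1))" by simp
  have "s \<noteq> 0" using \<open>e \<noteq> 0\<close> e by auto
  have "0 \<le> 2 * s * e + s\<^sup>2 * a" by (rule assms(1))
  also have "\<dots> = - (s\<^sup>2 * (a + 2))"
    unfolding e by (simp add: algebra_simps power2_eq_square)
  also have "\<dots> < 0"
    using \<open>s \<noteq> 0\<close> assms(2) by simp
  finally show False by simp
qed

lemma tendsto_L2_inner:
  assumes "\<And>n. f n \<in> L2 M" "g \<in> L2 M" "h \<in> L2 M" "((\<lambda>n. L2_norm M (f n - g)) \<longlongrightarrow> 0) F"
  shows "((\<lambda>n. L2_inner M (f n) h) \<longlongrightarrow> L2_inner M g h) F"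
proof (rule LIM_zero_cancel, rule tendsto_0_le[OF assms(4)])
  show "\<forall>\<^sub>F n in F. norm (L2_inner M (f n) h - L2_inner M g h) \<le> norm (L2_norm M (f n - g)) * L2_norm M h"
    using L2_Cauchy_Schwarz[of "f _ - g" M h] assms by (auto intro!: always_eventually)
qed

text \<open>The solution of \<open>K f = g\<close> is the minimiser of \<open>\<langle>f, K f\<rangle> - 2 Re \<langle>g, f\<rangle>\<close>: minimising sequences in \<open>D\<close>
  are Cauchy by the parallelogram identity, their limit solves the equation weakly, and
  self-adjointness puts the limit into \<open>D\<close>.\<close>
lemma L2_coercive_surjective:
  assumes K: "L2_self_adjoint M D K" and c: "0 < c"
    and coercive: "\<And>f. f \<in> D \<Longrightarrow> c * (L2_norm M f)\<^sup>2 \<le> Re (L2_inner M f (K f))"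
    and g: "g \<in> L2 M"
  obtains f where "f \<in> D" "ae_eq M (K f) g"
proof -
  note KS = L2_self_adjointD[OF K]
  note KD = L2_operatorD[OF KS(1)]
  define a where "a f = Re (L2_inner M f (K f))" for f
  define J where "J f = a f - 2 * Re (L2_inner M g f)" for f
  have a_nonneg: "0 \<le> a f" if "f \<in> D" for f
    unfolding a_def by (rule order_trans[OF _ coercive[OF that]]) (use c in simp)
  have J_expand: "J (x + scl (of_real s) z) = J x + 2 * s * (Re (L2_inner M x (K z)) - Re (L2_inner M g z)) + s\<^sup>2 * a z"
    if "x \<in> D" "z \<in> D" for x z s
    using L2_form_expand(2)[OF K that, of s] that g KD(1) by (simp add: J_def a_def algebra_simps)
  have J_bound: "- ((L2_norm M g)\<^sup>2 / c) \<le> J f" if f: "f \<in> D" for f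
  proof -
    have "0 \<le> (c * L2_norm M f - L2_norm M g)\<^sup>2 / c" using c by simp
    also have "\<dots> = c * (L2_norm M f)\<^sup>2 - 2 * (L2_norm M g * L2_norm M f) + (L2_norm M g)\<^sup>2 / c"
      using c by (simp add: field_simps power2_eq_square)
    finally show ?thesis
      using coercive[OF f] complex_Re_le_cmod[of "L2_inner M g f"] L2_Cauchy_Schwarz[OF g KD(1)[OF f]]
      unfolding J_def a_def by linarith
  qed
  define j where "j = Inf (J ` D)"
  have bdd: "bdd_below (J ` D)" using J_bound by (intro bdd_belowI2)
  have j: "j \<le> J f" if "f \<in> D" for f
    unfolding j_def using that bdd by (intro cInf_lower) auto
  \<comment> \<open>The excess over the infimum controls squared distances, so
    \<open>(1/4)^n\<close> produces increments of ratio 1/2.\<close>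
  have "\<exists>f\<in>D. J f < j + (1 / 4) ^ n" for n :: nat
  proof -
    have "Inf (J ` D) < j + (1 / 4) ^ n" by (simp add: j_def)
    then show ?thesis using cInf_less_iff[OF _ bdd] KD(3) by blast
  qed
  then obtain f where f: "\<And>n. f n \<in> D" "\<And>n::nat. J (f n) < j + (1 / 4) ^ n" by metis
  have "L2_norm M (f (Suc n) - f n) \<le> (2 / sqrt c) * (1 / 2) ^ n" for n
  proof -
    let ?z = "f (Suc n) - f n"
    have z: "?z \<in> D" using KD(5)[OF f(1) f(1), of 1 "Suc n" "-1" n] by (simp add: diff_eq_add_scl)
    define E where "E = Re (L2_inner M (f n) (K ?z)) - Re (L2_inner M g ?z)"
    have "f (Suc n) = f n + scl (of_real 1) ?z" by simp
    then have 1: "J (f (Suc n)) = J (f n) + 2 * 1 * E + 1\<^sup>2 * a ?z"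
      unfolding E_def using J_expand[OF f(1) z, of n 1] by metis
    have 2: "J (f n + scl (of_real (1 / 2)) ?z) = J (f n) + 2 * (1 / 2) * E + (1 / 2)\<^sup>2 * a ?z"
      unfolding E_def by (rule J_expand[OF f(1) z])
    \<comment> \<open>The average of \<open>J\<close> at the two ends exceeds its midpoint value by
      exactly \<open>a ?z / 4\<close>, and the midpoint value is at least \<open>j\<close>.\<close>
    have "j \<le> J (f n + scl (of_real (1 / 2)) ?z)"
      by (rule j[OF L2_form_expand(1)[OF K f(1) z]])
    then have "a ?z / 4 \<le> (1 / 4) ^ n"
      using 1 2 f(2)[of n] f(2)[of "Suc n"] zero_le_power[of "1 / 4 :: real" n]
      unfolding power2_eq_square power_Suc by linarith
    moreover have q: "((1 / 2) ^ n)\<^sup>2 = (1 / 4 :: real) ^ n"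
      unfolding power2_eq_square power_mult_distrib[symmetric] by simp
    ultimately have "c * (L2_norm M ?z)\<^sup>2 \<le> 4 * (1 / 4) ^ n"
      using coercive[OF z] by (simp add: a_def)
    also have "\<dots> = c * ((2 / sqrt c) * (1 / 2) ^ n)\<^sup>2"
      unfolding power_mult_distrib q using c by (simp add: power_divide)
    finally have "(L2_norm M ?z)\<^sup>2 \<le> ((2 / sqrt c) * (1 / 2) ^ n)\<^sup>2"
      by (rule mult_left_le_imp_le[OF _ c])
    then show ?thesis
      by (rule power2_le_imp_le) (use c in simp)
  qed
  then obtain u where u: "u \<in> L2 M" "\<And>n. L2_norm M (u - f n) \<le> (2 / sqrt c) * (1 / 2) ^ n / (1 - 1 / 2)"
    using L2_complete_geometric[of f M "1/2" "2 / sqrt c"] f(1) KD(1) c by auto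
  have "(\<lambda>n. (2 / sqrt c) * (1 / 2) ^ n / (1 - 1 / 2)) \<longlonglongrightarrow> (2 / sqrt c) * 0 / (1 - 1 / 2)"
    by (intro tendsto_intros LIMSEQ_power_zero) auto
  then have lim: "(\<lambda>n. L2_norm M (f n - u)) \<longlonglongrightarrow> 0"
    using u(2) by (intro tendsto_sandwich[of "\<lambda>_. 0" "\<lambda>n. L2_norm M (f n - u)"])
      (auto simp: L2_norm_minus_commute[of M _ u])
  have weak_Re: "Re (L2_inner M u (K z)) = Re (L2_inner M g z)" if z: "z \<in> D" for z
  proof -
    \<comment> \<open>Compare \<open>j\<close> with \<open>J (f n + s z)\<close> and let n grow.
      Only \<open>L2_inner M (f n) (K z)\<close> passes to the limit, so nothing is asked of
      \<open>K u\<close> before \<open>u\<close> is known to lie in \<open>D\<close>.\<close>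
    have "0 \<le> 2 * s * (Re (L2_inner M u (K z)) - Re (L2_inner M g z)) + s\<^sup>2 * a z" for s
    proof (rule LIMSEQ_le)
      show "(\<lambda>n. 2 * s * (Re (L2_inner M (f n) (K z)) - Re (L2_inner M g z)) + s\<^sup>2 * a z)
        \<longlonglongrightarrow> 2 * s * (Re (L2_inner M u (K z)) - Re (L2_inner M g z)) + s\<^sup>2 * a z"
        by (intro tendsto_intros tendsto_L2_inner lim u KD f z)
      show "(\<lambda>n. - ((1 / 4) ^ n :: real)) \<longlonglongrightarrow> 0"
        using tendsto_minus[OF LIMSEQ_power_zero[of "1/4 :: real"]] by simp
      show "\<exists>N. \<forall>n\<ge>N. - ((1 / 4) ^ n) \<le> 2 * s * (Re (L2_inner M (f n) (K z)) - Re (L2_inner M g z)) + s\<^sup>2 * a z"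
        using j[OF L2_form_expand(1)[OF K f(1) z]] f(2) unfolding J_expand[OF f(1) z]
        by (smt (verit, best))
    qed
    then show ?thesis using linear_part_eq_0 a_nonneg[OF z] by fastforce
  qed
  have weak: "L2_inner M u (K z) = L2_inner M g z" if z: "z \<in> D" for z
  proof (rule complex_eqI[OF weak_Re[OF z]])
    \<comment> \<open>Testing with \<open>\<i> z\<close> turns the real part into the imaginary
      part, up to sign.\<close>
    have iz: "scl \<i> z \<in> D" "ae_eq M (K (scl \<i> z)) (scl \<i> (K z))"
      using KD(5)[OF z z, of \<i> 0] KD(6)[OF z z, of \<i> 0]
      by (simp_all add: scl_def plus_fun_def)
    have "L2_inner M u (K (scl \<i> z)) = L2_inner M u (scl \<i> (K z))"
      by (intro L2_inner_cong ae_eq_refl iz KD(2) L2_scl u z)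
    then show "Im (L2_inner M u (K z)) = Im (L2_inner M g z)"
      using weak_Re[OF iz(1)] by simp
  qed
  have weak': "L2_inner M (K z) u = L2_inner M z g" if "z \<in> D" for z
    using weak[OF that] by (metis L2_inner_commute)
  have uD: "u \<in> D" by (rule KS(3)[OF u(1) g weak'])
  have "L2_norm M (K u - g) = 0"
  proof (rule L2_orthogonal_dense)
    show "L2_inner M z (K u - g) = 0" if "z \<in> D" for z
      using that KD(1,2) KS(4) uD g weak' by simp
    show "\<exists>h\<in>D. L2_norm M (K u - g - h) < e" if "0 < e" for e
      by (rule KS(2)[OF L2_diff[OF KD(2)[OF uD] g] that])
    show "D \<subseteq> L2 M" using KD(1) by auto
    show "K u - g \<in> L2 M" by (intro L2_diff KD(2) uD g)
  qed
  then have "ae_eq M (K u) g"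
    using KD(2)[OF uD] g by (simp add: ae_eq_iff_L2_norm)
  with uD show thesis by (rule that)
qed

text \<open>Cauchy-Schwarz for the nonnegative form, in discriminant shape: solve
  \<open>K g = f\<close> and evaluate the form at \<open>g - C f\<close>. Symmetry makes the cross
  term \<parallel>f\<parallel>^2, the bound on the inverse gives \<langle>g, K g\<rangle> \<le> C
  \<parallel>f\<parallel>^2, and the claim remains.\<close>

lemma L2_coercive_if_invertible:
  assumes K: "L2_self_adjoint M D K"
    and nonneg: "\<And>f. f \<in> D \<Longrightarrow> 0 \<le> Re (L2_inner M f (K f))"
    and surj: "\<And>g. g \<in> L2 M \<Longrightarrow> \<exists>f\<in>D. ae_eq M (K f) g"
    and C: "0 < C" "\<And>f. f \<in> D \<Longrightarrow> L2_norm M f \<le> C * L2_norm M (K f)"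
    and f: "f \<in> D"
  shows "(L2_norm M f)\<^sup>2 / C \<le> Re (L2_inner M f (K f))"
proof -
  note KS = L2_self_adjointD[OF K]
  note KD = L2_operatorD[OF KS(1)]
  obtain g where g: "g \<in> D" "ae_eq M (K g) f" using surj KD(1)[OF f] by blast
  note [simp] = KD(1,2)[OF f] KD(1,2)[OF g(1)]
  have "Re (L2_inner M g (K g)) \<le> L2_norm M g * L2_norm M (K g)"
    by (rule order_trans[OF complex_Re_le_cmod L2_Cauchy_Schwarz]) simp_all
  also have "\<dots> \<le> C * L2_norm M (K g) * L2_norm M (K g)"
    by (intro mult_right_mono C g) simp
  also have "L2_norm M (K g) = L2_norm M f"
    using g by (intro L2_norm_cong) auto
  finally have 1: "Re (L2_inner M g (K g)) \<le> C * (L2_norm M f)\<^sup>2" by (simp add: power2_eq_square)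
  have "L2_inner M g (K f) = L2_inner M (K g) f" using KS(4)[OF g(1) f] by simp
  also have "\<dots> = L2_inner M f f" using g by (intro L2_inner_cong) auto
  finally have 2: "Re (L2_inner M g (K f)) = (L2_norm M f)\<^sup>2" by (simp add: L2_norm_power2)
  have "0 \<le> Re (L2_inner M g (K g)) + 2 * (- C) * Re (L2_inner M g (K f)) + (- C)\<^sup>2 * Re (L2_inner M f (K f))"
    using nonneg[OF L2_form_expand(1)[OF K g(1) f]] unfolding L2_form_expand(2)[OF K g(1) f] .
  then have "C * (L2_norm M f)\<^sup>2 \<le> C * (C * Re (L2_inner M f (K f)))"
    using 1 unfolding 2 by (simp add: power2_eq_square)
  then show ?thesis using C(1) by (simp add: divide_le_eq mult.commute)
qed

text \<open>If \<open>m\<close> were in the resolvent set, the bounded inverse would raise the form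
  bound by a fixed positive amount, against \<open>sharp\<close>. For real \<open>r < m\<close> the
  shifted form is coercive with constant \<open>m - r\<close>, which yields surjectivity and the
  resolvent estimate.\<close>

lemma spectral_bottom_eqI:
  assumes K: "L2_self_adjoint M D K"
    and lower: "\<And>f. f \<in> D \<Longrightarrow> m * (L2_norm M f)\<^sup>2 \<le> Re (L2_inner M f (K f))"
    and sharp: "\<And>\<epsilon>. 0 < \<epsilon> \<Longrightarrow> \<exists>f\<in>D. Re (L2_inner M f (K f)) < (m + \<epsilon>) * (L2_norm M f)\<^sup>2"
  shows "spectral_bottom M D K = m"
proof -
  note KS = L2_self_adjointD[OF K]
  note KD = L2_operatorD[OF KS(1)]
  have shift_form: "Re (L2_inner M f (shift_op r K f)) = Re (L2_inner M f (K f)) - r * (L2_norm M f)\<^sup>2"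
    if "f \<in> D" for f r
    using KD(1,2)[OF that] by (simp add: shift_op_def L2_norm_power2)
  have shift_L2: "shift_op r K f \<in> L2 M" if "f \<in> D" for f r
    using KD(1,2) that by (simp add: shift_op_def)
  have shift: "(\<lambda>x. K f x - complex_of_real r * f x) = shift_op r K f" for f r
    by (simp add: shift_op_def fun_eq_iff)
  have "of_real m \<in> L2_spectrum M D K"
  proof (rule ccontr)
    assume "complex_of_real m \<notin> L2_spectrum M D K"
    then have surj: "\<And>g. g \<in> L2 M \<Longrightarrow> \<exists>f\<in>D. ae_eq M (shift_op m K f) g"
      and "\<exists>C. \<forall>f\<in>D. L2_norm M f \<le> C * L2_norm M (shift_op m K f)"
      unfolding L2_spectrum_def L2_resolvent_set_def Compl_iff mem_Collect_eq not_not shift by simp_all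
    then obtain C where C: "\<And>f. f \<in> D \<Longrightarrow> L2_norm M f \<le> C * L2_norm M (shift_op m K f)" by blast
    \<comment> \<open>The resolvent set supplies some real constant, perhaps not positive; its
      maximum with 1 can be divided by.\<close>
    have C': "L2_norm M f \<le> max C 1 * L2_norm M (shift_op m K f)" if "f \<in> D" for f
      by (rule order_trans[OF C[OF that] mult_right_mono]) simp_all
    obtain f where f: "f \<in> D" "Re (L2_inner M f (K f)) < (m + 1 / max C 1) * (L2_norm M f)\<^sup>2"
      using sharp[of "1 / max C 1"] by (auto simp: less_max_iff_disj)
    have "(L2_norm M f)\<^sup>2 / max C 1 \<le> Re (L2_inner M f (shift_op m K f))"
      by (rule L2_coercive_if_invertible[OF L2_self_adjoint_shift[OF K] _ surj _ C' f(1)])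
         (use lower shift_form in auto)
    then show False using f by (simp add: shift_form algebra_simps)
  qed
  moreover have "m \<le> r" if "complex_of_real r \<in> L2_spectrum M D K" for r
  proof (rule ccontr)
    assume "\<not> m \<le> r"
    then have c: "0 < m - r" by simp
    have coercive: "(m - r) * (L2_norm M f)\<^sup>2 \<le> Re (L2_inner M f (shift_op r K f))" if "f \<in> D" for f
      using lower[OF that] by (simp add: shift_form[OF that] algebra_simps)
    have bound: "L2_norm M f \<le> 1 / (m - r) * L2_norm M (shift_op r K f)" if f: "f \<in> D" for f
    proof (cases "L2_norm M f = 0")
      case False
      then have pos: "0 < L2_norm M f" using L2_norm_nonneg[of M f] by linarith
      have "(m - r) * (L2_norm M f)\<^sup>2 \<le> L2_norm M f * L2_norm M (shift_op r K f)"
        using coercive[OF f] complex_Re_le_cmod L2_Cauchy_Schwarz[OF KD(1)[OF f] shift_L2[OF f]]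
        by (meson order_trans)
      then have "L2_norm M f * ((m - r) * L2_norm M f) \<le> L2_norm M f * L2_norm M (shift_op r K f)"
        by (simp add: power2_eq_square mult_ac)
      from mult_left_le_imp_le[OF this pos] show ?thesis
        using c by (simp add: pos_le_divide_eq mult.commute)
    qed (use c in simp)
    have "complex_of_real r \<in> L2_resolvent_set M D K"
      unfolding L2_resolvent_set_def shift mem_Collect_eq
    proof (intro conjI ballI impI)
      show "\<exists>f\<in>D. ae_eq M (shift_op r K f) g" if "g \<in> L2 M" for g
        using L2_coercive_surjective[OF L2_self_adjoint_shift[OF K] c coercive that] by blast
      show "ae_eq M f (\<lambda>x. 0)" if f: "f \<in> D" and 0: "ae_eq M (shift_op r K f) (\<lambda>x. 0)" for f
      proof -
        have "L2_norm M (shift_op r K f) = 0"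
          using 0 L2_norm_eq_0_iff[OF shift_L2[OF f]] by (simp add: zero_fun_def)
        then have "L2_norm M f = 0" using bound[OF f] L2_norm_nonneg[of M f] by simp
        then show ?thesis using L2_norm_eq_0_iff[OF KD(1)[OF f]] by (simp add: zero_fun_def)
      qed
    qed (use bound in blast)
    then show False using that by (simp add: L2_spectrum_def)
  qed
  ultimately show ?thesis
    unfolding spectral_bottom_def by (intro cInf_eq_minimum) auto
qed

section \<open>Semigroups and their generators\<close>

lemma L2_norm_triangle3:
  assumes "f \<in> L2 M" "g \<in> L2 M" "h \<in> L2 M"
  shows "L2_norm M (f + g + h) \<le> L2_norm M f + L2_norm M g + L2_norm M h"
  using L2_norm_triangle[of "f + g" M h] L2_norm_triangle[of f M g] assms by simp

text \<open>The sign of the exponent is the one that makes \<open>- (K - r)\<close> the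
  generator.\<close>

definition shift_semigroup ::
    "real \<Rightarrow> (real \<Rightarrow> ('a \<Rightarrow> complex) \<Rightarrow> 'a \<Rightarrow> complex) \<Rightarrow> real \<Rightarrow> ('a \<Rightarrow> complex) \<Rightarrow> 'a \<Rightarrow> complex" where
  "shift_semigroup r T t f = scl (of_real (exp (r * t))) (T t f)"

text \<open>The product rule at 0 for \<open>exp (r * h)\<close> times \<open>u h\<close>. The
  family \<open>u\<close> is arbitrary so that the same statement, with \<open>- r\<close>, also
  undoes a shift.\<close>

lemma shift_generator:
  assumes lim: "((\<lambda>h. L2_norm M (scl (1 / of_real h) (u h - f) - g)) \<longlongrightarrow> 0) (at_right 0)"
    and u: "\<And>h. 0 \<le> h \<Longrightarrow> u h \<in> L2 M" and f: "f \<in> L2 M" and g: "g \<in> L2 M"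
  shows "((\<lambda>h. L2_norm M (scl (1 / of_real h) (scl (of_real (exp (r * h))) (u h) - f) - (g + scl (of_real r) f)))
    \<longlongrightarrow> 0) (at_right 0)"
proof (rule tendsto_sandwich[OF _ _ tendsto_const])
  let ?b = "\<lambda>h. exp (r * h) * L2_norm M (scl (1 / of_real h) (u h - f) - g)
    + \<bar>(exp (r * h) - 1) / h - r\<bar> * L2_norm M f + \<bar>exp (r * h) - 1\<bar> * L2_norm M g"
  have "((\<lambda>x. exp (r * x)) has_real_derivative r) (at_right 0)"
    by (auto intro!: derivative_eq_intros)
  then have "((\<lambda>h. (exp (r * h) - 1) / h) \<longlongrightarrow> r) (at_right 0)"
    by (simp add: has_field_derivative_iff)
  then have 1: "((\<lambda>h. \<bar>(exp (r * h) - 1) / h - r\<bar>) \<longlongrightarrow> 0) (at_right 0)"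
    by (intro tendsto_rabs_zero LIM_zero)
  have 2: "((\<lambda>h. exp (r * h)) \<longlongrightarrow> exp (r * 0)) (at_right 0)"
    by (intro tendsto_intros)
  have 3: "((\<lambda>h. \<bar>exp (r * h) - 1\<bar>) \<longlongrightarrow> 0) (at_right 0)"
    using 2 by (intro tendsto_rabs_zero LIM_zero) simp
  have "(?b \<longlongrightarrow> exp (r * 0) * 0 + 0 * L2_norm M f + 0 * L2_norm M g) (at_right 0)"
    by (intro tendsto_add tendsto_mult 1 2 3 lim tendsto_const)
  then show "(?b \<longlongrightarrow> 0) (at_right 0)" by simp
  show "\<forall>\<^sub>F h in at_right 0. L2_norm M (scl (1 / of_real h) (scl (of_real (exp (r * h))) (u h) - f) - (g + scl (of_real r) f)) \<le> ?b h"
  proof (rule eventually_at_right_less[THEN eventually_mono])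
    fix h :: real assume h: "0 < h"
    note uh = u[OF less_imp_le[OF h]]
    have eq: "scl (1 / of_real h) (scl (of_real (exp (r * h))) (u h) - f) - (g + scl (of_real r) f)
      = scl (of_real (exp (r * h))) (scl (1 / of_real h) (u h - f) - g)
        + scl (of_real ((exp (r * h) - 1) / h - r)) f + scl (of_real (exp (r * h) - 1)) g"
      using h by (simp add: fun_eq_iff field_simps)
    show "L2_norm M (scl (1 / of_real h) (scl (of_real (exp (r * h))) (u h) - f) - (g + scl (of_real r) f)) \<le> ?b h"
      unfolding eq
      by (rule order_trans[OF L2_norm_triangle3]) (use uh f g in \<open>simp_all only: L2_norm_scl norm_of_real L2_scl L2_diff abs_exp_cancel order_refl\<close>)
  qed
qed simp

lemma L2_bounded_op_scl_op:
  assumes A: "L2_bounded_op M A" shows "L2_bounded_op M (\<lambda>f. scl c (A f))"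
proof -
  obtain C where C: "\<And>f. f \<in> L2 M \<Longrightarrow> L2_norm M (A f) \<le> C * L2_norm M f"
    using A unfolding L2_bounded_op_def by blast
  have lin: "ae_eq M (A (\<lambda>x. a * f x + b * g x)) (\<lambda>x. a * A f x + b * A g x)"
    if "f \<in> L2 M" "g \<in> L2 M" for f g a b
    using A that unfolding L2_bounded_op_def by blast
  show ?thesis
    unfolding L2_bounded_op_def
  proof (intro conjI ballI impI allI)
    show "ae_eq M (scl c (A (\<lambda>x. a * f x + b * g x))) (\<lambda>x. a * scl c (A f) x + b * scl c (A g) x)"
      if "f \<in> L2 M" "g \<in> L2 M" for f g a b
      using lin[OF that, of a b] unfolding ae_eq_def by eventually_elim (simp add: algebra_simps)
    have "L2_norm M (scl c (A f)) \<le> (cmod c * C) * L2_norm M f" if "f \<in> L2 M" for f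
      using mult_left_mono[OF C[OF that], of "cmod c"] by (simp add: mult.assoc)
    then show "\<exists>C. \<forall>f\<in>L2 M. L2_norm M (scl c (A f)) \<le> C * L2_norm M f" by blast
  qed (use A in \<open>auto simp: L2_bounded_op_def intro: ae_eq_scl\<close>)
qed

section \<open>Orbits: shifts, local bounds and invariance of the domain\<close>

locale L2_semigroup =
  fixes M :: "'a measure"
    and D :: "('a \<Rightarrow> complex) set"
    and K :: "('a \<Rightarrow> complex) \<Rightarrow> 'a \<Rightarrow> complex"
    and T :: "real \<Rightarrow> ('a \<Rightarrow> complex) \<Rightarrow> 'a \<Rightarrow> complex"
  assumes K: "L2_self_adjoint M D K" and T: "generates_semigroup M D K T"
begin

lemmas KS = L2_self_adjointD[OF K]
lemmas KD = L2_operatorD[OF KS(1)]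

lemma T_bounded: "0 \<le> t \<Longrightarrow> L2_bounded_op M (T t)"
  using T by (simp add: generates_semigroup_def)

lemmas T_L2 [simp] = L2_bounded_op_L2[OF T_bounded]
lemmas T_add = L2_bounded_op_add[OF T_bounded]
lemmas T_diff = L2_bounded_op_diff[OF T_bounded]
lemmas T_scl = L2_bounded_op_scl[OF T_bounded]

lemma T_0: "f \<in> L2 M \<Longrightarrow> ae_eq M (T 0 f) f"
  using T by (simp add: generates_semigroup_def)

lemma T_semigroup: "0 \<le> s \<Longrightarrow> 0 \<le> t \<Longrightarrow> f \<in> L2 M \<Longrightarrow> ae_eq M (T (s + t) f) (T s (T t f))"
  using T by (simp add: generates_semigroup_def)

lemma T_commute:
  assumes "0 \<le> s" "0 \<le> t" "f \<in> L2 M" shows "ae_eq M (T s (T t f)) (T t (T s f))"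
  using ae_eq_trans[OF ae_eq_sym[OF T_semigroup[of s t f]]] T_semigroup[of t s f] assms
  by (simp add: add.commute)

lemma T_continuous: "f \<in> L2 M \<Longrightarrow> ((\<lambda>t. L2_norm M (T t f - f)) \<longlongrightarrow> 0) (at_right 0)"
  using T by (simp add: generates_semigroup_def fun_diff_def)

lemma T_generator:
  "f \<in> D \<Longrightarrow> ((\<lambda>h. L2_norm M (scl (1 / of_real h) (T h f - f) + K f)) \<longlongrightarrow> 0) (at_right 0)"
  using T KD(1) by (simp add: generates_semigroup_def scl_def plus_fun_def)

lemma T_generator_domI:
  "f \<in> L2 M \<Longrightarrow> g \<in> L2 M \<Longrightarrow> ((\<lambda>h. L2_norm M (scl (1 / of_real h) (T h f - f) - g)) \<longlongrightarrow> 0) (at_right 0) \<Longrightarrow> f \<in> D"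
  using T by (auto simp add: generates_semigroup_def scl_def fun_diff_def)

lemma semigroup_shift: "L2_semigroup M D (shift_op r K) (shift_semigroup r T)"
proof
  show "L2_self_adjoint M D (shift_op r K)" by (rule L2_self_adjoint_shift[OF K])
  let ?S = "shift_semigroup r T"
  have S_L2: "?S t f \<in> L2 M" if "0 \<le> t" "f \<in> L2 M" for t f
    using that by (simp add: shift_semigroup_def)
  have sg: "ae_eq M (?S (s + t) f) (?S s (?S t f))" if st: "0 \<le> s" "0 \<le> t" "f \<in> L2 M" for s t f
  proof -
    have "ae_eq M (T (s + t) f) (T s (T t f))" using st by (rule T_semigroup)
    moreover have "ae_eq M (T s (?S t f)) (scl (of_real (exp (r * t))) (T s (T t f)))"
      unfolding shift_semigroup_def using st by (intro T_scl) auto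
    ultimately show ?thesis
      unfolding ae_eq_def by eventually_elim (simp add: shift_semigroup_def distrib_left exp_add)
  qed
  have cont: "((\<lambda>t. L2_norm M (?S t f - f)) \<longlongrightarrow> 0) (at_right 0)" if f: "f \<in> L2 M" for f
  proof (rule tendsto_sandwich[OF _ _ tendsto_const])
    let ?b = "\<lambda>t. exp (r * t) * L2_norm M (T t f - f) + \<bar>exp (r * t) - 1\<bar> * L2_norm M f"
    have 2: "((\<lambda>h. exp (r * h)) \<longlongrightarrow> exp (r * 0)) (at_right 0)"
      by (intro tendsto_intros)
    have 3: "((\<lambda>h. \<bar>exp (r * h) - 1\<bar>) \<longlongrightarrow> 0) (at_right 0)"
      using 2 by (intro tendsto_rabs_zero LIM_zero) simp
    have "(?b \<longlongrightarrow> exp (r * 0) * 0 + 0 * L2_norm M f) (at_right 0)"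
      by (intro tendsto_add tendsto_mult 2 3 T_continuous f tendsto_const)
    then show "(?b \<longlongrightarrow> 0) (at_right 0)" by simp
    show "\<forall>\<^sub>F t in at_right 0. L2_norm M (?S t f - f) \<le> ?b t"
    proof (rule eventually_at_right_less[THEN eventually_mono])
      fix t :: real assume t: "0 < t"
      have eq: "?S t f - f = scl (of_real (exp (r * t))) (T t f - f) + scl (of_real (exp (r * t) - 1)) f"
        by (simp add: shift_semigroup_def fun_eq_iff algebra_simps)
      show "L2_norm M (?S t f - f) \<le> ?b t"
        unfolding eq
        by (rule order_trans[OF L2_norm_triangle])
           (use f t in \<open>simp_all only: L2_norm_scl norm_of_real L2_scl L2_diff T_L2 less_imp_le abs_exp_cancel order_refl\<close>)
    qed
  qed simp
  have gen: "((\<lambda>h. L2_norm M (scl (1 / of_real h) (?S h f - f) + shift_op r K f)) \<longlongrightarrow> 0) (at_right 0)" if f: "f \<in> D" for f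
  proof -
    have "((\<lambda>h. L2_norm M (scl (1 / of_real h) (T h f - f) - scl (-1) (K f))) \<longlongrightarrow> 0) (at_right 0)"
      using T_generator[OF f] by simp
    from shift_generator[OF this, of r]
    have "((\<lambda>h. L2_norm M (scl (1 / of_real h) (?S h f - f) - (scl (-1) (K f) + scl (of_real r) f))) \<longlongrightarrow> 0) (at_right 0)"
      using f KD(1,2) by (simp add: shift_semigroup_def)
    moreover have "scl (1 / of_real h) (?S h f - f) - (scl (-1) (K f) + scl (of_real r) f)
       = scl (1 / of_real h) (?S h f - f) + shift_op r K f" for h
      by (simp add: fun_eq_iff shift_op_def)
    ultimately show ?thesis by simp
  qed
  \<comment> \<open>The product rule with \<open>- r\<close> turns a generator limit of the shifted
    semigroup into one of \<open>T\<close>; this carries over the clause that keeps the domain from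
    being too small.\<close>
  have genI: "f \<in> D" if f: "f \<in> L2 M" and g: "g \<in> L2 M"
    and lim: "((\<lambda>h. L2_norm M (scl (1 / of_real h) (?S h f - f) - g)) \<longlongrightarrow> 0) (at_right 0)" for f g
  proof (rule T_generator_domI[OF f])
    show "g + scl (of_real (- r)) f \<in> L2 M" using f g by simp
    have "scl (of_real (exp (- r * h))) (?S h f) = T h f" for h
      by (simp add: fun_eq_iff shift_semigroup_def exp_minus flip: of_real_mult mult.assoc)
    then show "((\<lambda>h. L2_norm M (scl (1 / of_real h) (T h f - f) - (g + scl (of_real (- r)) f))) \<longlongrightarrow> 0) (at_right 0)"
      using shift_generator[OF lim S_L2[OF _ f] f g, of "- r"] by simp
  qed
  have bdd: "L2_bounded_op M (?S t)" if "0 \<le> t" for t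
    using L2_bounded_op_scl_op[OF T_bounded[OF that]] by (simp add: shift_semigroup_def[abs_def])
  have S0: "ae_eq M (?S 0 f) f" if "f \<in> L2 M" for f
    using T_0[OF that] by (simp add: shift_semigroup_def)
  show "generates_semigroup M D (shift_op r K) ?S"
    unfolding generates_semigroup_def
  proof (intro conjI allI impI ballI)
    show "((\<lambda>t. L2_norm M (\<lambda>x. ?S t f x - f x)) \<longlongrightarrow> 0) (at_right 0)" if "f \<in> L2 M" for f
      using cont[OF that] by (simp add: fun_diff_def)
    show "((\<lambda>h. L2_norm M (\<lambda>x. (?S h f x - f x) / complex_of_real h + shift_op r K f x)) \<longlongrightarrow> 0) (at_right 0)"
      if "f \<in> D" for f
      using gen[OF that] by (simp add: scl_def plus_fun_def)
    show "f \<in> D" if "f \<in> L2 M"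
      "\<exists>g\<in>L2 M. ((\<lambda>h. L2_norm M (\<lambda>x. (?S h f x - f x) / complex_of_real h - g x)) \<longlongrightarrow> 0) (at_right 0)" for f
      using that genI by (auto simp: scl_def fun_diff_def)
  qed (use bdd S0 sg in auto)
qed

text \<open>Otherwise times \<open>t n \<le> 1 / (n + 1)\<close> exist at which the operator norm
  exceeds \<open>4^n\<close>. The gliding hump then gives one \<open>x\<close> with \<parallel>T (t
  n) x\<parallel> unbounded, against strong continuity at 0.\<close>

lemma T_bounded_near_0:
  "\<exists>n::nat. \<forall>t\<in>{0..1 / (real n + 1)}. \<forall>f\<in>L2 M. L2_norm M (T t f) \<le> 4 ^ n * L2_norm M f"
proof (rule ccontr)
  assume "\<not> ?thesis"
  then have "\<forall>n::nat. \<exists>t. t \<in> {0..1 / (real n + 1)} \<and> (\<exists>f\<in>L2 M. 4 ^ n * L2_norm M f < L2_norm M (T t f))"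
    by (metis not_le)
  then obtain t where t: "\<And>n::nat. t n \<in> {0..1 / (real n + 1)}"
    and big: "\<And>n. \<exists>f\<in>L2 M. 4 ^ n * L2_norm M f < L2_norm M (T (t n) f)"
    by metis
  \<comment> \<open>The filter \<open>at_right 0\<close> requires positive times. Time 0 is excluded
    because \<open>T 0\<close> acts as the identity and has the bound
    \<open>1 \<le> 4^n\<close>.\<close>
  have t_pos: "0 < t n" for n
  proof (rule ccontr)
    assume "\<not> 0 < t n"
    then have [simp]: "t n = 0" using t[of n] by simp
    obtain f where f: "f \<in> L2 M" "4 ^ n * L2_norm M f < L2_norm M (T (t n) f)" using big by blast
    have "L2_norm M (T 0 f) = L2_norm M f" using f T_0 by (intro L2_norm_cong) auto
    moreover have "1 * L2_norm M f \<le> 4 ^ n * L2_norm M f" by (intro mult_right_mono) auto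
    ultimately show False using f(2) by simp
  qed
  obtain x where x: "x \<in> L2 M" "\<And>n. (4 / 3) ^ n / 4 \<le> L2_norm M (T (t n) x)"
    using L2_gliding_hump[of M "\<lambda>n. T (t n)"] T_bounded t big by (metis atLeastAtMost_iff)
  have "t \<longlonglongrightarrow> 0"
  proof (rule tendsto_sandwich[OF _ _ tendsto_const LIMSEQ_inverse_real_of_nat])
    show "\<forall>\<^sub>F n in sequentially. t n \<le> inverse (real (Suc n))"
      using t by (auto simp: inverse_eq_divide add.commute)
  qed (use t in auto)
  then have "filterlim t (at_right 0) sequentially"
    by (simp add: filterlim_at t_pos less_imp_neq[OF t_pos, THEN not_sym])
  from filterlim_compose[OF T_continuous[OF x(1)] this]
  have "\<forall>\<^sub>F n in sequentially. L2_norm M (T (t n) x - x) < 1"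
    by (rule order_tendstoD) simp
  moreover have "filterlim (\<lambda>n. (4 / 3 :: real) ^ n) at_top sequentially"
    by (rule filterlim_at_infinity_imp_filterlim_at_top[OF filterlim_realpow_sequentially_gt1]) simp_all
  then have "\<forall>\<^sub>F n in sequentially. 4 * (L2_norm M x + 1) < (4 / 3) ^ n"
    by (simp add: filterlim_at_top_dense)
  ultimately have "\<forall>\<^sub>F n in sequentially. False"
  proof eventually_elim
    case (elim n)
    have "L2_norm M (T (t n) x) \<le> L2_norm M x + L2_norm M (T (t n) x - x)"
      using x t[of n] by (intro L2_norm_triangle_diff) auto
    also have "\<dots> < L2_norm M x + 1" using elim(1) by simp
    also have "\<dots> < (4 / 3) ^ n / 4" using elim(2) by (simp only: less_divide_eq) simp
    finally show ?case using x(2)[of n] by simp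
  qed
  then show False by simp
qed

text \<open>Cutting \<open>s\<close> into pieces of length at most \<delta> multiplies the
  short-time bound \<open>4^n\<close>. As this bound is at least 1, a single power serves all of
  \<open>[0, t]\<close>.\<close>

lemma T_locally_bounded:
  obtains C where "1 \<le> C" "\<And>s f. 0 \<le> s \<Longrightarrow> s \<le> t \<Longrightarrow> f \<in> L2 M \<Longrightarrow> L2_norm M (T s f) \<le> C * L2_norm M f"
proof -
  obtain n :: nat where n: "\<And>t f. t \<in> {0..1 / (real n + 1)} \<Longrightarrow> f \<in> L2 M \<Longrightarrow> L2_norm M (T t f) \<le> 4 ^ n * L2_norm M f"
    using T_bounded_near_0 by blast
  define \<delta> where "\<delta> = 1 / (real n + 1)"
  have \<delta>: "0 < \<delta>" by (simp add: \<delta>_def)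
  have *: "L2_norm M (T s f) \<le> (4 ^ n) ^ Suc k * L2_norm M f"
    if "0 \<le> s" "s \<le> real (Suc k) * \<delta>" "f \<in> L2 M" for k s f
    using that
  proof (induction k arbitrary: s)
    case 0
    then show ?case using n[of s f] by (simp add: \<delta>_def)
  next
    case (Suc k)
    show ?case
    proof (cases "s \<le> \<delta>")
      case True
      have "L2_norm M (T s f) \<le> 4 ^ n * L2_norm M f" using n[of s f] True Suc by (simp add: \<delta>_def)
      also have "\<dots> = (4 ^ n) ^ 1 * L2_norm M f" by simp
      also have "\<dots> \<le> (4 ^ n) ^ Suc (Suc k) * L2_norm M f"
        by (intro mult_right_mono power_increasing) auto
      finally show ?thesis .
    next
      case False
      have "L2_norm M (T s f) = L2_norm M (T \<delta> (T (s - \<delta>) f))"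
        using T_semigroup[of \<delta> "s - \<delta>" f] False \<delta> Suc.prems by (intro L2_norm_cong) auto
      also have "\<dots> \<le> 4 ^ n * L2_norm M (T (s - \<delta>) f)"
        using False \<delta> Suc.prems by (intro n) (auto simp: \<delta>_def)
      also have "\<dots> \<le> 4 ^ n * ((4 ^ n) ^ Suc k * L2_norm M f)"
        using False Suc.prems by (intro mult_left_mono Suc.IH) (auto simp: algebra_simps)
      finally show ?thesis by (simp add: mult.assoc)
    qed
  qed
  obtain k :: nat where "t / \<delta> \<le> real k" using real_arch_simple by blast
  then have "t \<le> real (Suc k) * \<delta>" using \<delta> by (simp add: field_simps)
  then show thesis
    using * by (intro that[of "(4 ^ n) ^ Suc k"]) (auto intro: one_le_power order_trans simp del: power_Suc)
qed

text \<open>\<open>T a\<close> commutes with the difference quotient. With \<open>g = K f\<close> it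
  carries the whole generator error along the orbit.\<close>

lemma T_diff_quotient:
  assumes a: "0 \<le> a" and h: "0 \<le> h" and f: "f \<in> L2 M" and g: "g \<in> L2 M"
  shows "ae_eq M (T a (scl c (T h f - f) + g)) (scl c (T h (T a f) - T a f) + T a g)"
proof -
  have "ae_eq M (T a (scl c (T h f - f) + g)) (T a (scl c (T h f - f)) + T a g)"
    using assms by (intro T_add) auto
  moreover have "ae_eq M (T a (scl c (T h f - f))) (scl c (T a (T h f - f)))"
    using assms by (intro T_scl) auto
  moreover have "ae_eq M (T a (T h f - f)) (T a (T h f) - T a f)"
    using assms by (intro T_diff) auto
  moreover have "ae_eq M (T a (T h f)) (T h (T a f))"
    using assms by (intro T_commute) auto
  ultimately show ?thesis
    unfolding ae_eq_def by eventually_elim simp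
qed

text \<open>Applying the bounded operator \<open>T a\<close> to the difference quotients of
  \<open>f\<close> shows that those of \<open>T a f\<close> converge to \<open>- T a (K f)\<close>.
  The converse clause of the generator puts \<open>T a f\<close> into \<open>D\<close>, and
  uniqueness of the limit identifies \<open>K (T a f)\<close>.\<close>

lemma T_domain:
  assumes f: "f \<in> D" and a: "0 \<le> a"
  shows "T a f \<in> D" "ae_eq M (K (T a f)) (T a (K f))"
proof -
  note [simp] = KD(1,2)[OF f]
  obtain C where C: "\<And>g. g \<in> L2 M \<Longrightarrow> L2_norm M (T a g) \<le> C * L2_norm M g"
    using T_locally_bounded[of a] a by (metis order_refl)
  let ?q = "\<lambda>h. scl (1 / of_real h) (T h (T a f) - T a f)"
  have lim: "((\<lambda>h. L2_norm M (?q h + T a (K f))) \<longlongrightarrow> 0) (at_right 0)"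
  proof (rule tendsto_sandwich[OF _ _ tendsto_const])
    show "((\<lambda>h. C * L2_norm M (scl (1 / of_real h) (T h f - f) + K f)) \<longlongrightarrow> 0) (at_right 0)"
      using tendsto_mult_left[OF T_generator[OF f], of C] by simp
    show "\<forall>\<^sub>F h in at_right 0. L2_norm M (?q h + T a (K f)) \<le> C * L2_norm M (scl (1 / of_real h) (T h f - f) + K f)"
    proof (rule eventually_at_right_less[THEN eventually_mono])
      fix h :: real assume "0 < h"
      then have h: "0 \<le> h" by simp
      have "L2_norm M (?q h + T a (K f)) = L2_norm M (T a (scl (1 / of_real h) (T h f - f) + K f))"
        using a h by (intro L2_norm_cong ae_eq_sym[OF T_diff_quotient]) auto
      also have "\<dots> \<le> C * L2_norm M (scl (1 / of_real h) (T h f - f) + K f)"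
        using h by (intro C) auto
      finally show "L2_norm M (?q h + T a (K f)) \<le> C * L2_norm M (scl (1 / of_real h) (T h f - f) + K f)" .
    qed
  qed simp
  show TD: "T a f \<in> D"
  proof (rule T_generator_domI)
    show "((\<lambda>h. L2_norm M (?q h - scl (-1) (T a (K f)))) \<longlongrightarrow> 0) (at_right 0)"
      using lim by simp
  qed (use a in auto)
  note [simp] = KD(1,2)[OF TD]
  have "L2_norm M (K (T a f) - T a (K f)) \<le> 0"
  proof (rule tendsto_lowerbound)
    show "((\<lambda>h. L2_norm M (?q h + K (T a f)) + L2_norm M (?q h + T a (K f))) \<longlongrightarrow> 0) (at_right 0)"
      using tendsto_add[OF T_generator[OF TD] lim] by simp
    show "\<forall>\<^sub>F h in at_right 0. L2_norm M (K (T a f) - T a (K f)) \<le> L2_norm M (?q h + K (T a f)) + L2_norm M (?q h + T a (K f))"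
    proof (rule eventually_at_right_less[THEN eventually_mono])
      fix h :: real assume "0 < h"
      then have "L2_norm M ((?q h + K (T a f)) - (?q h + T a (K f))) \<le> L2_norm M (?q h + K (T a f)) + L2_norm M (?q h + T a (K f))"
        using a by (intro L2_norm_diff_triangle) auto
      then show "L2_norm M (K (T a f) - T a (K f)) \<le> L2_norm M (?q h + K (T a f)) + L2_norm M (?q h + T a (K f))"
        by simp
    qed
  qed simp
  then show "ae_eq M (K (T a f)) (T a (K f))"
    using a L2_norm_nonneg[of M "K (T a f) - T a (K f)"] by (simp add: ae_eq_iff_L2_norm)
qed

end

section \<open>Symmetry and contractivity\<close>

lemma cmod_telescope_le:
  fixes w :: "nat \<Rightarrow> complex"
  assumes "\<And>k. k < n \<Longrightarrow> cmod (w (Suc k) - w k) \<le> e"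
  shows "cmod (w n - w 0) \<le> real n * e"
proof -
  have "cmod (\<Sum>k<n. w (Suc k) - w k) \<le> (\<Sum>k<n. e)"
    using assms by (intro order_trans[OF norm_sum sum_mono]) auto
  then show ?thesis by (simp add: sum_lessThan_telescope)
qed

lemma filterlim_divide_at_right_0:
  assumes "0 < (t::real)" shows "filterlim (\<lambda>n. t / real (Suc n)) (at_right 0) sequentially"
proof -
  have "(\<lambda>n. t / real (Suc n)) \<longlonglongrightarrow> 0"
    using tendsto_mult_left[OF LIMSEQ_inverse_real_of_nat, of t] by (simp add: divide_inverse)
  then show ?thesis using assms by (simp add: filterlim_at)
qed

lemma L2_dense_sequence:
  assumes "\<And>e. 0 < e \<Longrightarrow> \<exists>g\<in>D. L2_norm M (f - g) < e"
  obtains g where "\<And>n::nat. g n \<in> D" "(\<lambda>n. L2_norm M (g n - f)) \<longlonglongrightarrow> 0"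
proof -
  have "\<forall>n. \<exists>g\<in>D. L2_norm M (f - g) < inverse (real (Suc n))"
    using assms by simp
  then obtain g where g: "\<And>n. g n \<in> D" "\<And>n. L2_norm M (f - g n) < inverse (real (Suc n))" by metis
  have "(\<lambda>n. L2_norm M (g n - f)) \<longlonglongrightarrow> 0"
  proof (rule tendsto_sandwich[OF _ _ tendsto_const LIMSEQ_inverse_real_of_nat])
    show "\<forall>\<^sub>F n in sequentially. L2_norm M (g n - f) \<le> inverse (real (Suc n))"
      using g(2) by (auto simp: L2_norm_minus_commute[of M _ f] less_imp_le)
  qed simp
  with g(1) show thesis by (rule that)
qed

lemma tendsto_L2_norm:
  assumes "\<And>n. f n \<in> L2 M" "g \<in> L2 M" "((\<lambda>n. L2_norm M (f n - g)) \<longlongrightarrow> 0) F"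
  shows "((\<lambda>n. L2_norm M (f n)) \<longlongrightarrow> L2_norm M g) F"
proof (rule LIM_zero_cancel, rule tendsto_0_le[OF assms(3)])
  have "\<bar>L2_norm M (f n) - L2_norm M g\<bar> \<le> L2_norm M (f n - g)" for n
    using L2_norm_triangle_diff[of "f n" M g] L2_norm_triangle_diff[of g M "f n"] assms(1,2)
    by (simp add: abs_le_iff L2_norm_minus_commute[of M g])
  then show "\<forall>\<^sub>F n in F. norm (L2_norm M (f n) - L2_norm M g) \<le> norm (L2_norm M (f n - g)) * 1"
    by (auto intro!: always_eventually)
qed

lemma tendsto_L2_bounded_op:
  assumes A: "L2_bounded_op M A"
    and f: "\<And>n. f n \<in> L2 M" "g \<in> L2 M" "((\<lambda>n. L2_norm M (f n - g)) \<longlongrightarrow> 0) F"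
  shows "((\<lambda>n. L2_norm M (A (f n) - A g)) \<longlongrightarrow> 0) F"
proof -
  obtain C where C: "\<And>f. f \<in> L2 M \<Longrightarrow> L2_norm M (A f) \<le> C * L2_norm M f"
    using A unfolding L2_bounded_op_def by blast
  show ?thesis
  proof (rule tendsto_0_le[OF f(3)])
    have "L2_norm M (A (f n) - A g) \<le> L2_norm M (f n - g) * C" for n
    proof -
      have "L2_norm M (A (f n) - A g) = L2_norm M (A (f n - g))"
        by (intro L2_norm_cong ae_eq_sym[OF L2_bounded_op_diff[OF A]] L2_diff L2_bounded_op_L2[OF A] f)
      also have "\<dots> \<le> C * L2_norm M (f n - g)"
        by (intro C L2_diff f)
      finally show ?thesis by (simp add: mult.commute)
    qed
    then show "\<forall>\<^sub>F n in F. norm (L2_norm M (A (f n) - A g)) \<le> norm (L2_norm M (f n - g)) * C"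
      by (auto intro!: always_eventually)
  qed
qed

context L2_semigroup
begin

lemmas T_tendsto = tendsto_L2_bounded_op[OF T_bounded]

text \<open>The error per unit time of the approximation \<open>f - h K f\<close> to
  \<open>T h f\<close>, tending to 0 for \<open>f \<in> D\<close>. Bounding it at
  \<open>T a f\<close> by its value at \<open>f\<close> is what makes the step estimates uniform
  along an orbit.\<close>

abbreviation gen_err :: "('a \<Rightarrow> complex) \<Rightarrow> real \<Rightarrow> real" where
  "gen_err f h \<equiv> L2_norm M (scl (1 / of_real h) (T h f - f) + K f)"

lemma gen_err_T_le:
  assumes f: "f \<in> D" and a: "0 \<le> a" and h: "0 < h"
    and C: "\<And>g. g \<in> L2 M \<Longrightarrow> L2_norm M (T a g) \<le> C * L2_norm M g"
  shows "gen_err (T a f) h \<le> C * gen_err f h"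
proof -
  note Tf = T_domain[OF f a]
  note [simp] = KD(1,2)[OF f] KD(1,2)[OF Tf(1)]
  have "ae_eq M (T a (scl (1 / of_real h) (T h f - f) + K f)) (scl (1 / of_real h) (T h (T a f) - T a f) + T a (K f))"
    using a h by (intro T_diff_quotient) auto
  then have "ae_eq M (scl (1 / of_real h) (T h (T a f) - T a f) + K (T a f)) (T a (scl (1 / of_real h) (T h f - f) + K f))"
    using Tf(2) unfolding ae_eq_def by eventually_elim simp
  then have "gen_err (T a f) h = L2_norm M (T a (scl (1 / of_real h) (T h f - f) + K f))"
    using a h by (intro L2_norm_cong) auto
  also have "\<dots> \<le> C * gen_err f h"
    using h by (intro C) auto
  finally show ?thesis .
qed

text \<open>To first order both inner products change by -h times \<langle>K x, y\<rangle> =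
  \<langle>x, K y\<rangle>. These terms cancel, and only the two generator errors survive.\<close>

lemma T_sym_step:
  assumes x: "x \<in> D" and y: "y \<in> D" and h: "0 < h"
  shows "cmod (L2_inner M (T h x) y - L2_inner M x (T h y)) \<le> h * (gen_err x h * L2_norm M y + L2_norm M x * gen_err y h)"
proof -
  note [simp] = KD(1,2)[OF x] KD(1,2)[OF y]
  define qx where "qx = scl (1 / of_real h) (T h x - x) + K x"
  define qy where "qy = scl (1 / of_real h) (T h y - y) + K y"
  have q [simp]: "qx \<in> L2 M" "qy \<in> L2 M" using h by (simp_all add: qx_def qy_def)
  have "L2_inner M (T h x) y - L2_inner M x (T h y) = of_real h * (L2_inner M qx y - L2_inner M x qy)"
    using h KS(4)[OF x y] by (simp add: qx_def qy_def field_simps)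
  also have "cmod \<dots> = h * cmod (L2_inner M qx y - L2_inner M x qy)"
    using h by (simp add: norm_mult)
  also have "\<dots> \<le> h * (L2_norm M qx * L2_norm M y + L2_norm M x * L2_norm M qy)"
    using h by (intro mult_left_mono order_trans[OF norm_triangle_ineq4 add_mono] L2_Cauchy_Schwarz) auto
  finally show ?thesis by (simp add: qx_def qy_def)
qed

text \<open>\<open>\<langle>T t f, g\<rangle> - \<langle>f, T t g\<rangle>\<close> telescopes over \<open>\<langle>T (t - s) f, T s g\<rangle>\<close>, \<open>s = 0, t/n, 2t/n, \<dots>, t\<close>; each step costs \<open>o(1/n)\<close>
  uniformly, so no differentiability from the left is needed.\<close>
lemma T_sym_dom:
  assumes f: "f \<in> D" and g: "g \<in> D" and t: "0 < t"
  shows "L2_inner M (T t f) g = L2_inner M f (T t g)"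
proof -
  note [simp] = KD(1,2)[OF f] KD(1,2)[OF g]
  obtain C where C: "1 \<le> C" "\<And>s f. 0 \<le> s \<Longrightarrow> s \<le> t \<Longrightarrow> f \<in> L2 M \<Longrightarrow> L2_norm M (T s f) \<le> C * L2_norm M f"
    using T_locally_bounded[of t] by blast
  let ?e = "\<lambda>h. (C * gen_err f h) * (C * L2_norm M g) + (C * L2_norm M f) * (C * gen_err g h)"
  have bound: "cmod (L2_inner M f (T t g) - L2_inner M (T t f) g) \<le> t * ?e (t / real (Suc n))" for n
  proof -
    define h where "h = t / real (Suc n)"
    have h: "0 < h" using t by (simp add: h_def)
    have nh: "real (Suc n) * h = t" by (simp add: h_def)
    define w where "w k = L2_inner M (T ((real (Suc n) - real k) * h) f) (T (real k * h) g)" for k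
    have "cmod (w (Suc n) - w 0) \<le> real (Suc n) * (h * ?e h)"
    proof (rule cmod_telescope_le)
      fix k assume k: "k < Suc n"
      \<comment> \<open>Because \<open>k < Suc n\<close>, the natural subtraction does not truncate,
        and the remaining time before this step is \<open>h + a\<close>.\<close>
      define a where "a = real (n - k) * h"
      define b where "b = real k * h"
      have a: "0 \<le> a" "a \<le> t" unfolding nh[symmetric] a_def using h by (auto intro!: mult_right_mono)
      have b: "0 \<le> b" "b \<le> t" unfolding nh[symmetric] b_def using h k by (auto intro!: mult_right_mono)
      have args: "(real (Suc n) - real k) * h = h + a" "(real (Suc n) - real (Suc k)) * h = a" "real (Suc k) * h = h + b"
        using k by (auto simp: a_def b_def of_nat_diff algebra_simps)
      have "w k = L2_inner M (T h (T a f)) (T b g)"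
        unfolding w_def args b_def[symmetric] using a b h
        by (intro L2_inner_cong T_semigroup) auto
      moreover have "w (Suc k) = L2_inner M (T a f) (T h (T b g))"
        unfolding w_def args using a b h by (intro L2_inner_cong T_semigroup) auto
      ultimately have "cmod (w (Suc k) - w k) = cmod (L2_inner M (T h (T a f)) (T b g) - L2_inner M (T a f) (T h (T b g)))"
        by (simp add: norm_minus_commute)
      also have "\<dots> \<le> h * (gen_err (T a f) h * L2_norm M (T b g) + L2_norm M (T a f) * gen_err (T b g) h)"
        using a b h f g by (intro T_sym_step T_domain)
      also have "\<dots> \<le> h * ?e h"
        using a b h f g C by (intro mult_left_mono add_mono mult_mono gen_err_T_le mult_nonneg_nonneg) auto
      finally show "cmod (w (Suc k) - w k) \<le> h * ?e h" .
    qed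
    moreover have "w (Suc n) = L2_inner M f (T t g)"
      unfolding w_def nh using t by (auto intro!: L2_inner_cong T_0)
    moreover have "w 0 = L2_inner M (T t f) g"
      unfolding w_def using nh t by (auto intro!: L2_inner_cong T_0)
    ultimately show ?thesis
      using nh by (simp add: h_def)
  qed
  have "((\<lambda>h. t * ?e h) \<longlongrightarrow> t * ((C * 0) * (C * L2_norm M g) + (C * L2_norm M f) * (C * 0))) (at_right 0)"
    by (intro tendsto_intros T_generator f g)
  then have lim: "(\<lambda>n. t * ?e (t / real (Suc n))) \<longlonglongrightarrow> 0"
    using filterlim_compose[OF _ filterlim_divide_at_right_0[OF t]] by fastforce
  have "cmod (L2_inner M f (T t g) - L2_inner M (T t f) g) \<le> 0"
    by (rule tendsto_lowerbound[OF lim]) (use bound in \<open>auto intro!: always_eventually\<close>)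
  then show ?thesis by simp
qed

text \<open>Both sides are continuous in each slot and \<open>D\<close> is dense.
  \<open>step\<close> extends the left slot only; conjugating the outcome lets it be used a second
  time for the other slot.\<close>

lemma T_sym:
  assumes f: "f \<in> L2 M" and g: "g \<in> L2 M" and t: "0 \<le> t"
  shows "L2_inner M (T t f) g = L2_inner M f (T t g)"
proof (cases "t = 0")
  case True
  have "L2_inner M (T 0 f) g = L2_inner M f g" "L2_inner M f (T 0 g) = L2_inner M f g"
    using f g T_0 by (auto intro!: L2_inner_cong)
  then show ?thesis using True by simp
next
  case False
  then have t: "0 < t" using t by simp
  have step: "L2_inner M (T t f) g = L2_inner M f (T t g)"
    if f: "f \<in> L2 M" and g: "g \<in> L2 M" and eq: "\<And>u. u \<in> D \<Longrightarrow> L2_inner M (T t u) g = L2_inner M u (T t g)" for f g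
  proof -
    obtain u where u: "\<And>n::nat. u n \<in> D" "(\<lambda>n. L2_norm M (u n - f)) \<longlonglongrightarrow> 0"
      using L2_dense_sequence[of D M f] KS(2)[OF f] by blast
    have uL: "u n \<in> L2 M" for n using u KD(1) by auto
    have "(\<lambda>n. L2_inner M (T t (u n)) g) \<longlonglongrightarrow> L2_inner M (T t f) g"
      using t by (intro tendsto_L2_inner T_tendsto u uL f g T_L2) auto
    moreover have "(\<lambda>n. L2_inner M (u n) (T t g)) \<longlonglongrightarrow> L2_inner M f (T t g)"
      using t by (intro tendsto_L2_inner u uL f g T_L2) auto
    ultimately show ?thesis
      using eq u(1) by (simp add: LIMSEQ_unique)
  qed
  have 1: "L2_inner M (T t f) u = L2_inner M f (T t u)" if "f \<in> L2 M" "u \<in> D" for f u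
    by (rule step[OF that(1) KD(1)[OF that(2)] T_sym_dom[OF _ that(2) t]])
  have 2: "L2_inner M (T t u) g = L2_inner M u (T t g)" if "u \<in> D" for u
    using 1[OF g that] L2_inner_commute[of M g "T t u"] L2_inner_commute[of M "T t g" u] by simp
  show ?thesis by (rule step[OF f g 2])
qed

text \<open>This makes the inner product in the theorem a nonnegative real number and ties its
  logarithm to that of an orbit norm at half the time.\<close>

lemma L2_inner_T_eq:
  assumes f: "f \<in> L2 M" and t: "0 \<le> t"
  shows "L2_inner M f (T (2 * t) f) = of_real ((L2_norm M (T t f))\<^sup>2)"
proof -
  have "L2_inner M f (T (2 * t) f) = L2_inner M f (T t (T t f))"
    using f t T_semigroup[of t t f] by (intro L2_inner_cong) auto
  also have "\<dots> = L2_inner M (T t f) (T t f)"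
    using f t by (simp add: T_sym)
  finally show ?thesis by (simp add: L2_inner_self)
qed

text \<open>A backward Euler estimate. With \<open>x = T a f\<close> and
  \<open>y = T (h + a) f\<close>, nonnegativity of the form bounds \<parallel>y\<parallel> by
  \<parallel>y + h K y\<parallel>, and \<open>y + h K y\<close> is \<open>x\<close> up to two
  errors: the generator error at \<open>x\<close>, and \<open>h (K y - K x)\<close>, which equals
  \<open>h T a (T h (K f) - K f)\<close> and is small by strong continuity.\<close>

lemma T_contraction_step:
  assumes nonneg: "\<And>f. f \<in> D \<Longrightarrow> 0 \<le> Re (L2_inner M f (K f))"
    and f: "f \<in> D" and a: "0 \<le> a" and h: "0 < h" and C0: "0 \<le> C"
    and C: "\<And>g. g \<in> L2 M \<Longrightarrow> L2_norm M (T a g) \<le> C * L2_norm M g"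
  shows "L2_norm M (T (h + a) f) \<le> L2_norm M (T a f) + h * (C * (gen_err f h + L2_norm M (T h (K f) - K f)))"
proof -
  define x where "x = T a f"
  define y where "y = T (h + a) f"
  have x: "x \<in> D" "ae_eq M (K x) (T a (K f))"
    unfolding x_def using T_domain[OF f a] by auto
  have y: "y \<in> D" "ae_eq M (K y) (T (h + a) (K f))"
    unfolding y_def using T_domain[OF f, of "h + a"] a h by auto
  note [simp] = KD(1,2)[OF f] KD(1,2)[OF x(1)] KD(1,2)[OF y(1)]
  have [simp]: "T a f \<in> L2 M" "T h x \<in> L2 M" "T h (K f) \<in> L2 M" using a h by auto
  let ?q = "scl (1 / of_real h) (T h x - x) + K x"
  let ?z = "T a (T h (K f) - K f)"
  have [simp]: "?z \<in> L2 M" using a h by simp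
  have "(L2_norm M y)\<^sup>2 \<le> (L2_norm M (y + scl (of_real h) (K y)))\<^sup>2"
    using nonneg[OF y(1)] h by (subst L2_norm_add_power2) auto
  then have "L2_norm M y \<le> L2_norm M (y + scl (of_real h) (K y))"
    by (rule power2_le_imp_le) simp
  also have "\<dots> = L2_norm M (x + scl (of_real h) ?q + scl (of_real h) ?z)"
  proof (rule L2_norm_cong)
    have "ae_eq M y (T h x)"
      unfolding x_def y_def using a h by (intro T_semigroup) auto
    moreover have "ae_eq M ?z (T a (T h (K f)) - T a (K f))"
      using a h by (intro T_diff) auto
    moreover have "ae_eq M (K y) (T a (T h (K f)))"
      using y(2) T_semigroup[of a h "K f"] a h by (simp add: add.commute) (rule ae_eq_trans)
    ultimately show "ae_eq M (y + scl (of_real h) (K y)) (x + scl (of_real h) ?q + scl (of_real h) ?z)"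
      using x(2) unfolding ae_eq_def by eventually_elim (use h in \<open>simp add: distrib_left right_diff_distrib\<close>)
  qed (use h in auto)
  also have "\<dots> \<le> L2_norm M x + L2_norm M (scl (of_real h) ?q) + L2_norm M (scl (of_real h) ?z)"
    by (intro L2_norm_triangle3) simp_all
  also have "\<dots> = L2_norm M x + h * (gen_err x h + L2_norm M ?z)"
    using h by (simp add: algebra_simps)
  also have "\<dots> \<le> L2_norm M x + h * (C * gen_err f h + C * L2_norm M (T h (K f) - K f))"
    using h a f C unfolding x_def by (intro add_left_mono mult_left_mono add_mono gen_err_T_le) auto
  finally show ?thesis by (simp add: x_def y_def distrib_left)
qed

text \<open>There are \<open>Suc n\<close> steps of length \<open>t / Suc n\<close>, each losing its
  length times a quantity that vanishes with the step size, so the total loss tends to 0.\<close>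

lemma T_contraction_dom:
  assumes nonneg: "\<And>f. f \<in> D \<Longrightarrow> 0 \<le> Re (L2_inner M f (K f))"
    and f: "f \<in> D" and t: "0 < t"
  shows "L2_norm M (T t f) \<le> L2_norm M f"
proof -
  note [simp] = KD(1,2)[OF f]
  obtain C where C: "1 \<le> C" "\<And>s f. 0 \<le> s \<Longrightarrow> s \<le> t \<Longrightarrow> f \<in> L2 M \<Longrightarrow> L2_norm M (T s f) \<le> C * L2_norm M f"
    using T_locally_bounded[of t] by blast
  let ?e = "\<lambda>h. C * (gen_err f h + L2_norm M (T h (K f) - K f))"
  have bound: "L2_norm M (T t f) \<le> L2_norm M f + t * ?e (t / real (Suc n))" for n
  proof -
    define h where "h = t / real (Suc n)"
    have h: "0 < h" using t by (simp add: h_def)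
    have nh: "real (Suc n) * h = t" by (simp add: h_def)
    define e where "e = h * ?e h"
    have "L2_norm M (T (real k * h) f) \<le> L2_norm M f + real k * e" if "k \<le> Suc n" for k
      using that
    proof (induction k)
      case 0
      have "L2_norm M (T 0 f) = L2_norm M f" using T_0 by (intro L2_norm_cong) auto
      then show ?case by simp
    next
      case (Suc k)
      have k: "0 \<le> real k * h" "real k * h \<le> t"
        unfolding nh[symmetric] using h Suc.prems by (auto intro!: mult_right_mono)
      have "L2_norm M (T (real (Suc k) * h) f) = L2_norm M (T (h + real k * h) f)"
        by (simp add: algebra_simps)
      also have "\<dots> \<le> L2_norm M (T (real k * h) f) + e"
        unfolding e_def using C k by (intro T_contraction_step nonneg f h) auto
      also have "\<dots> \<le> L2_norm M f + real (Suc k) * e"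
        using Suc by (simp add: distrib_right)
      finally show ?case .
    qed
    from this[of "Suc n"] have "L2_norm M (T t f) \<le> L2_norm M f + real (Suc n) * e"
      unfolding nh by simp
    also have "real (Suc n) * e = t * ?e h"
      unfolding e_def mult.assoc[symmetric] nh ..
    finally show ?thesis unfolding h_def .
  qed
  have "((\<lambda>h. L2_norm M f + t * ?e h) \<longlongrightarrow> L2_norm M f + t * (C * (0 + 0))) (at_right 0)"
    by (intro tendsto_intros T_generator T_continuous f KD(2))
  then have lim: "(\<lambda>n. L2_norm M f + t * ?e (t / real (Suc n))) \<longlonglongrightarrow> L2_norm M f"
    using filterlim_compose[OF _ filterlim_divide_at_right_0[OF t]] by fastforce
  show ?thesis
    by (rule tendsto_lowerbound[OF lim]) (use bound in \<open>auto intro!: always_eventually\<close>)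
qed

text \<open>Used with \<open>D\<close> and \<open>c = 1\<close> for contractivity, and with the
  functions dominated by a strictly positive one for exponential decay.\<close>

lemma T_norm_le_if_dense:
  assumes t: "0 \<le> t" and E: "E \<subseteq> L2 M"
    and dense: "\<And>f e. f \<in> L2 M \<Longrightarrow> 0 < e \<Longrightarrow> \<exists>g\<in>E. L2_norm M (f - g) < e"
    and le: "\<And>f. f \<in> E \<Longrightarrow> L2_norm M (T t f) \<le> c * L2_norm M f"
    and f: "f \<in> L2 M"
  shows "L2_norm M (T t f) \<le> c * L2_norm M f"
proof -
  obtain u where u: "\<And>n::nat. u n \<in> E" "(\<lambda>n. L2_norm M (u n - f)) \<longlonglongrightarrow> 0"
    using L2_dense_sequence[of E M f] dense[OF f] by blast
  have uL: "u n \<in> L2 M" for n using u E by auto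
  show ?thesis
  proof (rule LIMSEQ_le)
    show "(\<lambda>n. L2_norm M (T t (u n))) \<longlonglongrightarrow> L2_norm M (T t f)"
      using t by (intro tendsto_L2_norm T_tendsto T_L2 u uL f) auto
    show "(\<lambda>n. c * L2_norm M (u n)) \<longlonglongrightarrow> c * L2_norm M f"
      by (intro tendsto_intros tendsto_L2_norm u uL f)
  qed (use le u in auto)
qed

lemma T_contraction:
  assumes nonneg: "\<And>f. f \<in> D \<Longrightarrow> 0 \<le> Re (L2_inner M f (K f))"
    and f: "f \<in> L2 M" and t: "0 \<le> t"
  shows "L2_norm M (T t f) \<le> L2_norm M f"
proof (cases "t = 0")
  case True
  then show ?thesis using f T_0 L2_norm_cong[OF T_0[OF f]] by simp
next
  case False
  have "L2_norm M (T t f) \<le> 1 * L2_norm M f"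
  proof (rule T_norm_le_if_dense[OF t _ KS(2) _ f])
    show "D \<subseteq> L2 M" using KD(1) by auto
    show "L2_norm M (T t u) \<le> 1 * L2_norm M u" if "u \<in> D" for u
      using T_contraction_dom[OF nonneg that] False t by simp
  qed
  then show ?thesis by simp
qed

text \<open>Cauchy-Schwarz and the decay give \<langle>f, T h f\<rangle> a real part of at most
  \<open>exp (- \<epsilon> * h) * \<parallel>f\<parallel>^2\<close>. Subtracting
  \<parallel>f\<parallel>^2 and dividing by \<open>h\<close> yields, in the limit, minus the form on
  one side and -\<epsilon> \<parallel>f\<parallel>^2 on the other.\<close>

lemma generator_lower_bound:
  assumes decay: "\<And>s f. 0 < s \<Longrightarrow> f \<in> L2 M \<Longrightarrow> L2_norm M (T s f) \<le> exp (- \<epsilon> * s) * L2_norm M f"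
    and f: "f \<in> D"
  shows "\<epsilon> * (L2_norm M f)\<^sup>2 \<le> Re (L2_inner M f (K f))"
proof -
  note [simp] = KD(1,2)[OF f]
  let ?N = "(L2_norm M f)\<^sup>2"
  have "((\<lambda>s. exp (- \<epsilon> * s)) has_real_derivative - \<epsilon>) (at_right 0)"
    by (auto intro!: derivative_eq_intros)
  then have "((\<lambda>h. (exp (- \<epsilon> * h) - 1) / h) \<longlongrightarrow> - \<epsilon>) (at_right 0)"
    by (simp add: has_field_derivative_iff)
  then have "((\<lambda>h. - ((exp (- \<epsilon> * h) - 1) / h) * ?N - L2_norm M f * gen_err f h) \<longlongrightarrow> - (- \<epsilon>) * ?N - L2_norm M f * 0) (at_right 0)"
    by (intro tendsto_intros T_generator f)
  then have lim: "((\<lambda>h. - ((exp (- \<epsilon> * h) - 1) / h) * ?N - L2_norm M f * gen_err f h) \<longlongrightarrow> \<epsilon> * ?N) (at_right 0)"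
    by simp
  show ?thesis
  proof (rule tendsto_upperbound[OF lim])
    show "\<forall>\<^sub>F h in at_right 0. - ((exp (- \<epsilon> * h) - 1) / h) * ?N - L2_norm M f * gen_err f h \<le> Re (L2_inner M f (K f))"
    proof (rule eventually_at_right_less[THEN eventually_mono])
      fix h :: real assume h: "0 < h"
      let ?q = "scl (1 / of_real h) (T h f - f) + K f"
      have "Re (L2_inner M f (T h f)) \<le> L2_norm M f * L2_norm M (T h f)"
        using h by (intro order_trans[OF complex_Re_le_cmod L2_Cauchy_Schwarz]) auto
      also have "\<dots> \<le> L2_norm M f * (exp (- \<epsilon> * h) * L2_norm M f)"
        using h by (intro mult_left_mono decay) auto
      finally have "Re (L2_inner M f (T h f)) - ?N \<le> (exp (- \<epsilon> * h) - 1) * ?N"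
        by (simp add: power2_eq_square algebra_simps)
      then have 1: "(Re (L2_inner M f (T h f)) - ?N) / h \<le> (exp (- \<epsilon> * h) - 1) * ?N / h"
        using h by (intro divide_right_mono) auto
      have "Re (L2_inner M f ?q) = (Re (L2_inner M f (T h f)) - ?N) / h + Re (L2_inner M f (K f))"
        using h by (simp add: L2_norm_power2 flip: of_real_divide)
      moreover have "- (L2_norm M f * L2_norm M ?q) \<le> Re (L2_inner M f ?q)"
        using abs_Re_le_cmod[of "L2_inner M f ?q"] L2_Cauchy_Schwarz[of f M ?q] h by (simp add: abs_le_iff)
      ultimately show "- ((exp (- \<epsilon> * h) - 1) / h) * ?N - L2_norm M f * gen_err f h \<le> Re (L2_inner M f (K f))"
        using 1 by simp
    qed
  qed simp
qed

end

section \<open>Positivity and the decay rate\<close>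

text \<open>Positivity applied to both \<open>f\<close> and \<open>c \<phi> - f\<close> squeezes
  \<open>A f\<close> pointwise between 0 and \<open>c A \<phi>\<close>.\<close>

lemma positivity_preserving_dominated_nonneg:
  assumes A: "L2_bounded_op M A" "positivity_preserving M A"
    and f: "f \<in> L2 M" and chi: "\<phi> \<in> L2 M" and c: "0 \<le> c"
    and le: "AE x in M. Im (f x) = 0 \<and> 0 \<le> Re (f x) \<and> Re (f x) \<le> c * Re (\<phi> x) \<and> Im (\<phi> x) = 0"
  shows "L2_norm M (A f) \<le> c * L2_norm M (A \<phi>)"
proof -
  note AL = L2_bounded_op_L2[OF A(1)]
  let ?g = "scl (of_real c) \<phi>"
  have "nonneg_fun M f" "nonneg_fun M (?g - f)"
    using le unfolding nonneg_fun_def by (eventually_elim, simp)+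
  then have "nonneg_fun M (A f)" "nonneg_fun M (A (?g - f))"
    using A(2) f chi by (simp_all add: positivity_preserving_def)
  moreover have "ae_eq M (A (?g - f)) (A ?g - A f)"
    using f chi by (intro L2_bounded_op_diff[OF A(1)]) auto
  moreover have "ae_eq M (A ?g) (scl (of_real c) (A \<phi>))"
    using chi by (intro L2_bounded_op_scl[OF A(1)]) auto
  ultimately have "AE x in M. cmod (A f x) \<le> cmod (scl (of_real c) (A \<phi>) x)"
    unfolding nonneg_fun_def ae_eq_def
  proof eventually_elim
    case (elim x)
    then have "cmod (A f x) = Re (A f x)" by (simp add: cmod_eq_Re)
    also have "\<dots> \<le> Re (scl (of_real c) (A \<phi>) x)" using elim by simp
    finally show ?case using complex_Re_le_cmod order_trans by blast
  qed
  then have "L2_norm M (A f) \<le> L2_norm M (scl (of_real c) (A \<phi>))"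
    using f chi by (intro L2_norm_mono AL L2_scl)
  then show ?thesis using c by simp
qed

lemma L2_bounded_op_norm_add_scl_le:
  assumes A: "L2_bounded_op M A" and "f \<in> L2 M" "g \<in> L2 M"
  shows "L2_norm M (A (f + scl a g)) \<le> L2_norm M (A f) + cmod a * L2_norm M (A g)"
proof -
  note AL = L2_bounded_op_L2[OF A]
  have "ae_eq M (A (f + scl a g)) (A f + A (scl a g))"
    using assms by (intro L2_bounded_op_add[OF A]) auto
  moreover have "ae_eq M (A (scl a g)) (scl a (A g))"
    using assms by (intro L2_bounded_op_scl[OF A]) auto
  ultimately have "ae_eq M (A (f + scl a g)) (A f + scl a (A g))"
    unfolding ae_eq_def by eventually_elim simp
  then have "L2_norm M (A (f + scl a g)) = L2_norm M (A f + scl a (A g))"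
    using assms by (intro L2_norm_cong AL L2_add L2_scl)
  also have "\<dots> \<le> L2_norm M (A f) + cmod a * L2_norm M (A g)"
    using L2_norm_triangle[of "A f" M "scl a (A g)"] assms AL by simp
  finally show ?thesis .
qed

text \<open>The factor 4 counts the positive and negative parts of real and imaginary part, each at
  most \<open>c \<phi>\<close>. Its size is harmless: the decay argument absorbs any
  constant.\<close>

lemma positivity_preserving_dominated:
  assumes A: "L2_bounded_op M A" "positivity_preserving M A"
    and f: "f \<in> L2 M" and chi: "\<phi> \<in> L2 M" and c: "0 \<le> c"
    and le: "AE x in M. cmod (f x) \<le> c * Re (\<phi> x)" and real: "AE x in M. Im (\<phi> x) = 0"
  shows "L2_norm M (A f) \<le> 4 * c * L2_norm M (A \<phi>)"
proof -
  define P where "P u = (\<lambda>x. complex_of_real (max 0 (u (f x))))" for u :: "complex \<Rightarrow> real"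
  have [measurable]: "f \<in> borel_measurable M" using f by (rule L2_measurable)
  have P: "P u \<in> L2 M" "L2_norm M (A (P u)) \<le> c * L2_norm M (A \<phi>)"
    if u: "\<And>z. \<bar>u z\<bar> \<le> cmod z" and [measurable]: "u \<in> borel_measurable borel" for u
  proof -
    have max: "max 0 (u z) \<le> cmod z" for z
      using abs_le_D1[OF u[of z]] by simp
    show PL: "P u \<in> L2 M"
      by (rule L2_cong_bound[OF f]) (use max in \<open>auto simp: P_def\<close>)
    have "AE x in M. Im (P u x) = 0 \<and> 0 \<le> Re (P u x) \<and> Re (P u x) \<le> c * Re (\<phi> x) \<and> Im (\<phi> x) = 0"
      using le real
    proof eventually_elim
      case (elim x)
      then show ?case using order_trans[OF max[of "f x"] elim(1)] by (simp add: P_def)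
    qed
    then show "L2_norm M (A (P u)) \<le> c * L2_norm M (A \<phi>)"
      by (rule positivity_preserving_dominated_nonneg[OF A PL chi c])
  qed
  have uminus: "(\<lambda>z. - Re z) \<in> borel_measurable borel" "(\<lambda>z. - Im z) \<in> borel_measurable borel" by measurable
  have bounds: "\<bar>- Re z\<bar> \<le> cmod z" "\<bar>- Im z\<bar> \<le> cmod z" for z
    by (simp_all add: abs_Re_le_cmod abs_Im_le_cmod)
  note P1 = P[of Re, OF abs_Re_le_cmod borel_measurable_Re]
    and P2 = P[of "\<lambda>z. - Re z", OF bounds(1) uminus(1)]
    and P3 = P[of Im, OF abs_Im_le_cmod borel_measurable_Im]
    and P4 = P[of "\<lambda>z. - Im z", OF bounds(2) uminus(2)]
  have "f = P Re + scl (-1) (P (\<lambda>z. - Re z)) + scl \<i> (P Im) + scl (- \<i>) (P (\<lambda>z. - Im z))"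
    by (auto simp: fun_eq_iff P_def complex_eq_iff max_def)
  then have "L2_norm M (A f)
      = L2_norm M (A (P Re + scl (-1) (P (\<lambda>z. - Re z)) + scl \<i> (P Im) + scl (- \<i>) (P (\<lambda>z. - Im z))))"
    by (rule arg_cong)
  also have "\<dots> \<le> L2_norm M (A (P Re)) + cmod (-1) * L2_norm M (A (P (\<lambda>z. - Re z)))
      + cmod \<i> * L2_norm M (A (P Im)) + cmod (- \<i>) * L2_norm M (A (P (\<lambda>z. - Im z)))"
    by (intro order_trans[OF L2_bounded_op_norm_add_scl_le[OF A(1)]] add_right_mono
        L2_bounded_op_norm_add_scl_le[OF A(1)] L2_add L2_scl P1 P2 P3 P4)
  also have "\<dots> \<le> 4 * c * L2_norm M (A \<phi>)"
    using P1(2) P2(2) P3(2) P4(2) by simp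
  finally show ?thesis .
qed

text \<open>Replace \<open>f\<close> by 0 wherever its modulus exceeds \<open>n \<phi>\<close>.
  Since \<phi> is positive almost everywhere, each such point is eventually kept, and dominated
  convergence applies.\<close>

lemma L2_dominated_dense:
  assumes f: "f \<in> L2 M" and chi: "\<phi> \<in> L2 M" and pos: "AE x in M. 0 < Re (\<phi> x)" and e: "0 < e"
  obtains g and n :: nat where "g \<in> L2 M" "AE x in M. cmod (g x) \<le> real n * Re (\<phi> x)" "L2_norm M (f - g) < e"
proof -
  have [measurable]: "f \<in> borel_measurable M" "\<phi> \<in> borel_measurable M"
    using f chi by (auto dest: L2_measurable)
  define g where "g n = (\<lambda>x. if cmod (f x) \<le> real n * Re (\<phi> x) then f x else 0)" for n :: nat
  have [measurable]: "g n \<in> borel_measurable M" for n unfolding g_def by measurable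
  have g: "g n \<in> L2 M" for n
    by (rule L2_cong_bound[OF f]) (auto simp: g_def)
  have "(\<lambda>n. LINT x|M. (cmod ((f - g n) x))\<^sup>2) \<longlonglongrightarrow> (LINT x|M. 0)"
  proof (rule integral_dominated_convergence)
    show "integrable M (\<lambda>x. (cmod (f x))\<^sup>2)" by (rule L2_integrable[OF f])
    show "AE x in M. (\<lambda>n. (cmod ((f - g n) x))\<^sup>2) \<longlonglongrightarrow> 0"
      using pos
    proof eventually_elim
      fix x assume x: "0 < Re (\<phi> x)"
      obtain N :: nat where N: "cmod (f x) / Re (\<phi> x) \<le> real N" using real_arch_simple by blast
      have "cmod (f x) \<le> real n * Re (\<phi> x)" if "N \<le> n" for n
      proof -
        have "cmod (f x) / Re (\<phi> x) \<le> real n" using N that by linarith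
        then show ?thesis using x by (simp add: divide_le_eq)
      qed
      then have "\<forall>\<^sub>F n in sequentially. (cmod ((f - g n) x))\<^sup>2 = 0"
        unfolding eventually_sequentially by (intro exI[of _ N]) (simp add: g_def)
      then show "(\<lambda>n. (cmod ((f - g n) x))\<^sup>2) \<longlonglongrightarrow> 0" by (rule tendsto_eventually)
    qed
  qed (auto simp: g_def)
  then have "(\<lambda>n. L2_norm M (f - g n)) \<longlonglongrightarrow> 0"
    using tendsto_real_sqrt by (fastforce simp: L2_norm_def)
  then have "\<forall>\<^sub>F n in sequentially. L2_norm M (f - g n) < e"
    using e by (rule order_tendstoD)
  then obtain n where n: "L2_norm M (f - g n) < e" using eventually_happens[of _ sequentially] by auto
  have "AE x in M. cmod (g n x) \<le> real n * Re (\<phi> x)"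
    using pos by eventually_elim (simp add: g_def)
  then show thesis using g n by (intro that)
qed

section \<open>Decay rates along orbits\<close>

context L2_semigroup
begin

lemma T_norm_log_convex:
  assumes "f \<in> L2 M" "0 \<le> t"
  shows "(L2_norm M (T t f))\<^sup>2 \<le> L2_norm M f * L2_norm M (T (2 * t) f)"
proof -
  have "(L2_norm M (T t f))\<^sup>2 = cmod (L2_inner M f (T (2 * t) f))"
    using assms by (simp add: L2_inner_T_eq norm_power)
  also have "\<dots> \<le> L2_norm M f * L2_norm M (T (2 * t) f)"
    using assms by (intro L2_Cauchy_Schwarz) auto
  finally show ?thesis .
qed

text \<open>Read as a lower bound: each doubling of the time at worst squares the ratio reached at
  \<open>s\<close>, so an orbit that is slow at one time stays slow at all its dyadic
  multiples.\<close>

lemma T_norm_doubling: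
  assumes f: "f \<in> L2 M" and s: "0 \<le> s" and pos: "0 < L2_norm M f"
  shows "L2_norm M f * (L2_norm M (T s f) / L2_norm M f) ^ (2 ^ n) \<le> L2_norm M (T (2 ^ n * s) f)"
proof (induction n)
  case 0
  then show ?case using pos by simp
next
  case (Suc n)
  let ?N = "L2_norm M f" and ?q = "L2_norm M (T s f) / L2_norm M f"
  have "?N * (?N * ?q ^ (2 ^ Suc n)) = (?N * ?q ^ (2 ^ n))\<^sup>2"
    by (simp add: power2_eq_square power_add mult_2 mult_ac)
  also have "\<dots> \<le> (L2_norm M (T (2 ^ n * s) f))\<^sup>2"
    using Suc.IH by (intro power_mono mult_nonneg_nonneg zero_le_power divide_nonneg_nonneg) auto
  also have "\<dots> \<le> ?N * L2_norm M (T (2 * (2 ^ n * s)) f)"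
    using f s by (intro T_norm_log_convex) auto
  finally show ?case
    using pos by (simp add: mult.assoc)
qed

text \<open>By the doubling inequality, decay of \<open>T t f\<close> at rate \<open>\<epsilon>\<close> along arbitrarily large times forces decay from
  the start. One loses a factor 2 in the rate since only times \<open>2\<^sup>n s\<close> are compared.\<close>
lemma T_decay_if_decay_at_infinity:
  assumes nonneg: "\<And>f. f \<in> D \<Longrightarrow> 0 \<le> Re (L2_inner M f (K f))"
    and f: "f \<in> L2 M" and psi: "\<psi> \<in> L2 M" and tau: "0 \<le> \<tau>" and eps: "0 < \<epsilon>" and s: "0 < s"
    and C: "0 < C" "\<And>t. 0 < t \<Longrightarrow> L2_norm M (T t f) \<le> C * L2_norm M (T (t + \<tau>) \<psi>)"
    and freq: "\<And>S. \<exists>t\<ge>S. L2_norm M (T t \<psi>) < exp (- \<epsilon> * t)"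
  shows "L2_norm M (T s f) \<le> exp (- (\<epsilon> / 2) * s) * L2_norm M f"
proof (rule ccontr)
  assume neg: "\<not> ?thesis"
  have "L2_norm M f \<noteq> 0"
    using neg T_contraction[OF nonneg f, of s] s by auto
  then have pos: "0 < L2_norm M f" using L2_norm_nonneg[of M f] by linarith
  define q where "q = L2_norm M (T s f) / L2_norm M f"
  define E where "E = exp (- (\<epsilon> / 2) * s)"
  have E: "0 < E" by (simp add: E_def)
  have "E < q" using neg pos by (simp add: q_def E_def less_divide_eq)
  then have beta: "1 < q / E" using E by simp
  \<comment> \<open>The contradiction will come from exponent \<open>2^n\<close> with
    \<open>N < n < 2^n\<close>, so a power beating \<open>C / \<parallel>f\<parallel>\<close> is
    fixed in advance.\<close>
  obtain N where N: "C / L2_norm M f < (q / E) ^ N" using real_arch_pow[OF beta] by blast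
  \<comment> \<open>A time beyond \<open>\<tau> + 2 ^ N * s\<close> forces the dyadic index chosen
    next to exceed \<open>N\<close>; the summand 1 makes this strict.\<close>
  obtain t where t: "\<tau> + 2 ^ N * s + 1 \<le> t" "L2_norm M (T t \<psi>) < exp (- \<epsilon> * t)" using freq by blast
  obtain j where "t / s < 2 ^ j" using real_arch_pow[of 2] by auto
  then have "t \<le> \<tau> + 2 ^ j * s" using s tau by (simp add: divide_less_eq)
  then have ex: "\<exists>j. t \<le> \<tau> + 2 ^ j * s" by blast
  \<comment> \<open>The least dyadic time \<open>\<tau> + 2^n s\<close> not before \<open>t\<close>.
    Contractivity carries smallness forward from \<open>t\<close> to it, while minimality gives
    \<open>2^n s / 2 \<le> t\<close>; this is where half of the rate is lost.\<close>
  define n where "n = (LEAST j. t \<le> \<tau> + 2 ^ j * s)"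
  have n: "t \<le> \<tau> + 2 ^ n * s" unfolding n_def by (rule LeastI_ex[OF ex])
  have "N < n"
  proof (rule ccontr)
    assume "\<not> N < n"
    then have "2 ^ n * s \<le> 2 ^ N * s" using s by (intro mult_right_mono power_increasing) auto
    then show False using n t(1) by linarith
  qed
  then obtain m where m: "n = Suc m" by (cases n) auto
  have "\<not> t \<le> \<tau> + 2 ^ m * s" using not_less_Least[of m "\<lambda>j. t \<le> \<tau> + 2 ^ j * s"] m by (simp add: n_def)
  then have half: "2 ^ n * s / 2 \<le> t" using tau m by simp
  have t0: "0 \<le> t" using t(1) tau s by (smt (verit) mult_nonneg_nonneg zero_le_power)
  have "L2_norm M f * q ^ (2 ^ n) \<le> L2_norm M (T (2 ^ n * s) f)"
    unfolding q_def using s by (intro T_norm_doubling f pos) auto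
  also have "\<dots> \<le> C * L2_norm M (T (2 ^ n * s + \<tau>) \<psi>)"
    using s by (intro C) auto
  also have "L2_norm M (T (2 ^ n * s + \<tau>) \<psi>) = L2_norm M (T (2 ^ n * s + \<tau> - t) (T t \<psi>))"
    using T_semigroup[of "2 ^ n * s + \<tau> - t" t \<psi>] n t0 s tau psi by (intro L2_norm_cong) auto
  also have "C * \<dots> \<le> C * L2_norm M (T t \<psi>)"
    using C(1) n t0 psi by (intro mult_left_mono T_contraction nonneg) auto
  also have "\<dots> \<le> C * exp (- \<epsilon> * t)"
    using C(1) t(2) by simp
  also have "\<dots> \<le> C * exp (- \<epsilon> * (2 ^ n * s / 2))"
    using C(1) half eps by simp
  also have "exp (- \<epsilon> * (2 ^ n * s / 2)) = E ^ (2 ^ n)"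
    unfolding E_def exp_of_nat_mult[symmetric] by (simp add: algebra_simps)
  finally have "L2_norm M f * q ^ (2 ^ n) \<le> C * E ^ (2 ^ n)" .
  then have "(q / E) ^ (2 ^ n) \<le> C / L2_norm M f"
    using pos E by (simp add: power_divide field_simps)
  moreover have "(q / E) ^ N \<le> (q / E) ^ (2 ^ n)"
    using beta less_trans[OF \<open>N < n\<close> less_exp] by (intro power_increasing less_imp_le)
  ultimately show False using N by linarith
qed

lemma eventually_exp_le_T_norm:
  assumes nonneg: "\<And>f. f \<in> D \<Longrightarrow> 0 \<le> Re (L2_inner M f (K f))"
    and sharp: "\<And>\<epsilon>. 0 < \<epsilon> \<Longrightarrow> \<exists>f\<in>D. Re (L2_inner M f (K f)) < \<epsilon> * (L2_norm M f)\<^sup>2"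
    and pp: "\<And>t. 0 < t \<Longrightarrow> positivity_preserving M (T t)"
    and psi: "\<psi> \<in> L2 M" and tau: "0 \<le> \<tau>" and chi: "strictly_pos_fun M (T \<tau> \<psi>)" and eps: "0 < \<epsilon>"
  shows "\<forall>\<^sub>F t in at_top. exp (- \<epsilon> * t) \<le> L2_norm M (T t \<psi>)"
proof (rule ccontr)
  assume "\<not> ?thesis"
  then have freq: "\<And>S. \<exists>t\<ge>S. L2_norm M (T t \<psi>) < exp (- \<epsilon> * t)"
    by (auto simp: eventually_at_top_linorder not_le)
  let ?\<phi> = "T \<tau> \<psi>"
  have chiL: "?\<phi> \<in> L2 M" using psi tau by simp
  have chi_pos: "AE x in M. 0 < Re (?\<phi> x)" and chi_real: "AE x in M. Im (?\<phi> x) = 0"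
    using chi unfolding strictly_pos_fun_def by (eventually_elim, simp)+
  let ?E = "{f \<in> L2 M. \<exists>n::nat. AE x in M. cmod (f x) \<le> real n * Re (?\<phi> x)}"
  have "L2_norm M (T s f) \<le> exp (- (\<epsilon> / 2) * s) * L2_norm M f" if s: "0 < s" and f: "f \<in> L2 M" for s f
  proof (rule T_norm_le_if_dense[of s ?E])
    fix g assume "g \<in> ?E"
    then obtain n :: nat where g: "g \<in> L2 M" "AE x in M. cmod (g x) \<le> real n * Re (?\<phi> x)" by auto
    show "L2_norm M (T s g) \<le> exp (- (\<epsilon> / 2) * s) * L2_norm M g"
    proof (rule T_decay_if_decay_at_infinity[OF nonneg g(1) psi tau eps s _ _ freq])
      \<comment> \<open>The added 1 keeps the constant positive when \<open>n = 0\<close>.\<close>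
      show "0 < 4 * real n + 1" by simp
      fix t :: real assume t: "0 < t"
      have "L2_norm M (T t g) \<le> 4 * real n * L2_norm M (T t ?\<phi>)"
        using t by (intro positivity_preserving_dominated T_bounded pp g chiL chi_real) auto
      also have "\<dots> \<le> (4 * real n + 1) * L2_norm M (T t ?\<phi>)"
        by (intro mult_right_mono) auto
      also have "L2_norm M (T t ?\<phi>) = L2_norm M (T (t + \<tau>) \<psi>)"
        using t tau psi by (intro L2_norm_cong ae_eq_sym[OF T_semigroup]) auto
      finally show "L2_norm M (T t g) \<le> (4 * real n + 1) * L2_norm M (T (t + \<tau>) \<psi>)" .
    qed
  next
    fix g and e :: real assume "g \<in> L2 M" "0 < e"
    then obtain h and n :: nat where "h \<in> L2 M" "AE x in M. cmod (h x) \<le> real n * Re (?\<phi> x)" "L2_norm M (g - h) < e"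
      using L2_dominated_dense[OF _ chiL chi_pos] by blast
    then show "\<exists>h\<in>?E. L2_norm M (g - h) < e" by blast
  qed (use s f in auto)
  then have "\<epsilon> / 2 * (L2_norm M f)\<^sup>2 \<le> Re (L2_inner M f (K f))" if "f \<in> D" for f
    using generator_lower_bound that by blast
  moreover obtain f where "f \<in> D" "Re (L2_inner M f (K f)) < \<epsilon> / 2 * (L2_norm M f)\<^sup>2"
    using sharp[of "\<epsilon> / 2"] eps by auto
  ultimately show False by fastforce
qed

lemma tendsto_spectral_bottom:
  assumes bdd: "L2_bounded_below M D K"
    and pp: "\<And>t. 0 < t \<Longrightarrow> positivity_preserving M (T t)"
    and psi: "\<psi> \<in> L2 M" "\<not> ae_eq M \<psi> (\<lambda>x. 0)"
    and tau: "0 \<le> \<tau>" "strictly_pos_fun M (T \<tau> \<psi>)"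
  shows "((\<lambda>t. - (1 / t) * ln (Re (L2_inner M \<psi> (T t \<psi>)))) \<longlongrightarrow> spectral_bottom M D K) at_top"
proof -
  have "L2_norm M \<psi> \<noteq> 0" using psi L2_norm_eq_0_iff by (auto simp: zero_fun_def)
  then have psi_pos: "0 < L2_norm M \<psi>" using L2_norm_nonneg[of M \<psi>] by linarith
  define R where "R f = Re (L2_inner M f (K f)) / (L2_norm M f)\<^sup>2" for f
  define B where "B = {f \<in> D. 0 < L2_norm M f}"
  obtain c where c: "\<And>f. f \<in> D \<Longrightarrow> c * (L2_norm M f)\<^sup>2 \<le> Re (L2_inner M f (K f))"
    using bdd by (auto simp: L2_bounded_below_def)
  have bddR: "bdd_below (R ` B)"
    using c by (intro bdd_belowI2[of _ c]) (auto simp: R_def B_def le_divide_eq)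
  \<comment> \<open>An element of the domain closer to \<psi> than \<parallel>\<psi>\<parallel> has
    positive norm, so the infimum of Rayleigh quotients is over a nonempty set.\<close>
  obtain g where g: "g \<in> D" "L2_norm M (\<psi> - g) < L2_norm M \<psi>" using KS(2)[OF psi(1) psi_pos] by blast
  then have "g \<in> B" using L2_norm_triangle_diff[OF psi(1) KD(1)[OF g(1)]] by (simp add: B_def)
  then have ne: "R ` B \<noteq> {}" by auto
  define m where "m = Inf (R ` B)"
  have lower: "m * (L2_norm M f)\<^sup>2 \<le> Re (L2_inner M f (K f))" if f: "f \<in> D" for f
  proof (cases "L2_norm M f = 0")
    case True
    then show ?thesis using c[OF f] by simp
  next
    case False
    then have fB: "f \<in> B" using f L2_norm_nonneg[of M f] by (simp add: B_def less_le)
    then have "m \<le> R f" unfolding m_def by (intro cInf_lower bddR) auto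
    then show ?thesis using fB by (simp add: R_def B_def le_divide_eq)
  qed
  have sharp: "\<exists>f\<in>D. Re (L2_inner M f (K f)) < (m + \<epsilon>) * (L2_norm M f)\<^sup>2" if "0 < \<epsilon>" for \<epsilon>
  proof -
    have "Inf (R ` B) < m + \<epsilon>" using that by (simp add: m_def)
    then obtain f where "f \<in> B" "R f < m + \<epsilon>" using cInf_less_iff[OF ne bddR] by auto
    then show ?thesis by (intro bexI[of _ f]) (auto simp: R_def B_def divide_less_eq)
  qed
  have bottom: "spectral_bottom M D K = m" by (rule spectral_bottom_eqI[OF K lower sharp])
  let ?S = "shift_semigroup m T"
  interpret S: L2_semigroup M D "shift_op m K" ?S by (rule semigroup_shift)
  have form: "Re (L2_inner M f (shift_op m K f)) = Re (L2_inner M f (K f)) - m * (L2_norm M f)\<^sup>2" if "f \<in> D" for f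
    using KD(1,2)[OF that] by (simp add: shift_op_def L2_norm_power2)
  have nonneg: "0 \<le> Re (L2_inner M f (shift_op m K f))" if "f \<in> D" for f
    using lower[OF that] by (simp add: form[OF that])
  \<comment> \<open>Half the time, since the inner product at \<open>t\<close> is the square of the
    norm at \<open>t / 2\<close>. The shift contributes the factor \<open>exp (- m * t)\<close>, so
    only \<open>ln (u t) = o(t)\<close> remains to be shown.\<close>
  define u where "u t = L2_norm M (?S (t / 2) \<psi>)" for t
  have lower_u: "\<forall>\<^sub>F t in at_top. exp (- \<epsilon> * (t / 2)) \<le> u t" if eps: "0 < \<epsilon>" for \<epsilon>
  proof -
    have "\<forall>\<^sub>F t in at_top. exp (- \<epsilon> * t) \<le> L2_norm M (?S t \<psi>)"
    proof (rule S.eventually_exp_le_T_norm[OF nonneg _ _ psi(1) tau(1) _ eps])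
      show "\<exists>f\<in>D. Re (L2_inner M f (shift_op m K f)) < \<epsilon>' * (L2_norm M f)\<^sup>2" if "0 < \<epsilon>'" for \<epsilon>'
        using sharp[OF that] by (auto simp: form algebra_simps)
      show "positivity_preserving M (?S t)" if "0 < t" for t
        unfolding positivity_preserving_def
      proof (intro ballI impI)
        fix f assume "f \<in> L2 M" "nonneg_fun M f"
        then have "nonneg_fun M (T t f)" using pp[OF that] by (simp add: positivity_preserving_def)
        then show "nonneg_fun M (?S t f)"
          unfolding nonneg_fun_def by eventually_elim (simp add: shift_semigroup_def)
      qed
      show "strictly_pos_fun M (?S \<tau> \<psi>)"
        using tau(2) unfolding strictly_pos_fun_def by eventually_elim (simp add: shift_semigroup_def)
    qed
    moreover have "filterlim (\<lambda>t::real. t / 2) at_top at_top"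
      using filterlim_tendsto_pos_mult_at_top[OF tendsto_const[of "1/2::real"] _ filterlim_ident] by simp
    ultimately show ?thesis
      unfolding u_def by (rule eventually_compose_filterlim)
  qed
  have upper_u: "u t \<le> L2_norm M \<psi>" if "0 \<le> t" for t
    unfolding u_def using that psi by (intro S.T_contraction nonneg) auto
  have inner: "Re (L2_inner M \<psi> (T t \<psi>)) = exp (- m * t) * (u t)\<^sup>2" if t: "0 \<le> t" for t
  proof -
    have "u t = exp (m * (t / 2)) * L2_norm M (T (t / 2) \<psi>)"
      by (simp add: u_def shift_semigroup_def)
    then have "(u t)\<^sup>2 = exp (m * t) * (L2_norm M (T (t / 2) \<psi>))\<^sup>2"
      by (simp add: power_mult_distrib exp_double[symmetric])
    then show ?thesis
      using L2_inner_T_eq[OF psi(1), of "t / 2"] t by (simp add: mult.assoc[symmetric] exp_add[symmetric])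
  qed
  have "((\<lambda>t. (2 / t) * ln (u t)) \<longlongrightarrow> 0) at_top"
  proof (rule order_tendstoI)
    \<comment> \<open>Rate \<open>\<epsilon> = - a / 2\<close> gives
      \<open>(2 / t) * ln (u t) \<ge> a / 2\<close>, strictly above \<open>a\<close> because
      \<open>a\<close> is negative.\<close>
    fix a :: real assume a: "a < 0"
    have "\<forall>\<^sub>F t in at_top. exp (a / 2 * (t / 2)) \<le> u t"
      using lower_u[of "- a / 2"] a by simp
    then show "\<forall>\<^sub>F t in at_top. a < 2 / t * ln (u t)"
      using eventually_gt_at_top[of 0]
    proof eventually_elim
      case (elim t)
      have "0 < u t" by (rule less_le_trans[OF exp_gt_zero elim(1)])
      then have "a / 2 * (t / 2) \<le> ln (u t)" using elim(1) ln_ge_iff by blast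
      then have "a * t / 4 \<le> ln (u t)" by simp
      then have "2 / t * (a * t / 4) \<le> 2 / t * ln (u t)" using elim by (intro mult_left_mono) auto
      then show ?case using elim a by simp
    qed
  next
    \<comment> \<open>Here \<open>lower_u\<close> with rate 1 secures positivity of
      \<open>u t\<close>, as comparing logarithms requires; the bound itself comes from
      contractivity.\<close>
    fix a :: real assume a: "0 < a"
    show "\<forall>\<^sub>F t in at_top. 2 / t * ln (u t) < a"
      using lower_u[OF zero_less_one] eventually_gt_at_top[of 0] eventually_gt_at_top[of "2 * ln (L2_norm M \<psi>) / a"]
    proof eventually_elim
      case (elim t)
      have "0 < u t" by (rule less_le_trans[OF exp_gt_zero elim(1)])
      then have "ln (u t) \<le> ln (L2_norm M \<psi>)" using upper_u[of t] elim by simp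
      moreover have "2 * ln (L2_norm M \<psi>) < a * t" using elim a by (simp add: divide_less_eq mult.commute)
      ultimately show ?case using elim by (simp add: divide_less_eq)
    qed
  qed
  then have lim: "((\<lambda>t. m - (2 / t) * ln (u t)) \<longlongrightarrow> m) at_top"
    using tendsto_diff[OF tendsto_const, of _ 0 at_top m] by simp
  show ?thesis
    unfolding bottom
  proof (rule Lim_transform_eventually[OF lim])
    show "\<forall>\<^sub>F t in at_top. m - 2 / t * ln (u t) = - (1 / t) * ln (Re (L2_inner M \<psi> (T t \<psi>)))"
      using lower_u[OF zero_less_one] eventually_gt_at_top[of 0]
    proof eventually_elim
      case (elim t)
      have "0 < u t" by (rule less_le_trans[OF exp_gt_zero elim(1)])
      then have ln: "ln (Re (L2_inner M \<psi> (T t \<psi>))) = - m * t + 2 * ln (u t)"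
        using elim(2) by (simp add: inner ln_mult ln_realpow)
      show ?case unfolding ln using elim(2) by (simp add: field_simps)
    qed
  qed
qed

end

text \<open>Improvement says nothing about functions vanishing almost everywhere; linearity and
  compatibility with \<open>ae_eq\<close> settle that case.\<close>

lemma positivity_improving_imp_preserving:
  assumes A: "L2_bounded_op M A" and imp: "positivity_improving M A"
  shows "positivity_preserving M A"
  unfolding positivity_preserving_def
proof (intro ballI impI)
  fix f assume f: "f \<in> L2 M" "nonneg_fun M f"
  show "nonneg_fun M (A f)"
  proof (cases "ae_eq M f (\<lambda>x. 0)")
    case True
    then have f0: "ae_eq M f (scl 0 f)" by (simp add: scl_def)
    have "ae_eq M (A f) (A (scl 0 f))" using f f0 by (intro L2_bounded_op_cong[OF A]) auto
    moreover have "ae_eq M (A (scl 0 f)) (scl 0 (A f))" using f by (intro L2_bounded_op_scl[OF A])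
    ultimately show ?thesis
      unfolding ae_eq_def nonneg_fun_def by eventually_elim simp
  next
    case False
    then have "strictly_pos_fun M (A f)" using imp f by (simp add: positivity_improving_def)
    then show ?thesis
      unfolding strictly_pos_fun_def nonneg_fun_def by eventually_elim simp
  qed
qed

text \<open>In the second part, the condition that \<psi> is not almost everywhere zero excludes the
  zero measure, on which strict positivity holds vacuously.\<close>

theorem mainTheorem16:
  fixes M :: "'a measure"
    and D :: "('a \<Rightarrow> complex) set"
    and K :: "('a \<Rightarrow> complex) \<Rightarrow> ('a \<Rightarrow> complex)"
    and T :: "real \<Rightarrow> ('a \<Rightarrow> complex) \<Rightarrow> ('a \<Rightarrow> complex)"
  assumes "sigma_finite_measure M"
    and "L2_self_adjoint M D K"
    and "L2_bounded_below M D K"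
    and "generates_semigroup M D K T"
  shows "((\<forall>t>0. positivity_improving M (T t)) \<longrightarrow>
           (\<forall>\<psi>\<in>L2 M. nonneg_fun M \<psi> \<and> \<not> ae_eq M \<psi> (\<lambda>x. 0) \<longrightarrow>
              ((\<lambda>t. - (1 / t) * ln (Re (L2_inner M \<psi> (T t \<psi>)))) \<longlongrightarrow> spectral_bottom M D K) at_top))
       \<and> ((\<forall>t>0. positivity_preserving M (T t)) \<longrightarrow>
           (\<forall>\<psi>\<in>L2 M. \<not> ae_eq M \<psi> (\<lambda>x. 0) \<and> (\<exists>\<tau>\<ge>0. strictly_pos_fun M (T \<tau> \<psi>)) \<longrightarrow>
              ((\<lambda>t. - (1 / t) * ln (Re (L2_inner M \<psi> (T t \<psi>)))) \<longlongrightarrow> spectral_bottom M D K) at_top))"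
proof -
  interpret L2_semigroup M D K T
    using assms by unfold_locales
  show ?thesis
  proof (intro conjI impI ballI)
    fix \<psi> assume imp: "\<forall>t>0. positivity_improving M (T t)"
      and psi: "\<psi> \<in> L2 M" "nonneg_fun M \<psi> \<and> \<not> ae_eq M \<psi> (\<lambda>x. 0)"
    \<comment> \<open>Any positive time would do; with \<tau> = 1 the improving case becomes an
      instance of the preserving one.\<close>
    have "strictly_pos_fun M (T 1 \<psi>)"
      using imp psi by (simp add: positivity_improving_def)
    moreover have "positivity_preserving M (T t)" if "0 < t" for t
      using imp that by (simp add: positivity_improving_imp_preserving T_bounded)
    ultimately show "((\<lambda>t. - (1 / t) * ln (Re (L2_inner M \<psi> (T t \<psi>)))) \<longlongrightarrow> spectral_bottom M D K) at_top"
      using psi assms(3) by (intro tendsto_spectral_bottom[where \<tau> = 1]) auto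
  next
    fix \<psi> assume "\<forall>t>0. positivity_preserving M (T t)" and "\<psi> \<in> L2 M"
      and "\<not> ae_eq M \<psi> (\<lambda>x. 0) \<and> (\<exists>\<tau>\<ge>0. strictly_pos_fun M (T \<tau> \<psi>))"
    then show "((\<lambda>t. - (1 / t) * ln (Re (L2_inner M \<psi> (T t \<psi>)))) \<longlongrightarrow> spectral_bottom M D K) at_top"
      using assms(3) by (blast intro: tendsto_spectral_bottom)
  qed
qed

end
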